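(* Let $A\in K(H)^{sa}$, let $\lambda_{\max}(A)$ have multiplicity $s\ge1$, and let $\mathcal{D}_{S_{\max}}=\mathrm{co}\{qq^*: q\in H,\ Aq=\lambda_{\max}(A)q,\ \|q\|=1\}$. Then the subdifferential of $\lambda_{\max}$ at $A$ is the set $$\partial\lambda_{\max}(A)=\mathcal{D}_{S_{\max}}=\{Y\in B_1(H)^{sa}: Y\ge0,\ E_+Y=YE_+=Y,\ \mathrm{tr}(Y)=1\},$$ where $E_+$ is the orthogonal projection onto the eigenspace of $\lambda_{\max}(A)$. In particular, if $\lambda_{\max}(A)\neq0$, then $$\partial\lambda_{\max}(A)=\{Q_{\max}R_sQ_{\max}^*: R_s\in M_s^h(\mathbb{C}),\ R_s\ge0,\ \mathrm{tr}(R_s)=1\},$$ where the columns of $Q_{\max}$ form an orthonormal basis of eigenvectors for $\lambda_{\max}(A)$.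
   Context: $H$ is a separable complex Hilbert space, $K(H)^{sa}$ the self-adjoint compact operators with the operator norm, $B_1(H)^{sa}$ the self-adjoint trace class operators, $M_s^h(\mathbb{C})$ the Hermitian $s\times s$ matrices, $\mathrm{co}$ the convex hull, and $qq^*$ the operator $y\mapsto\langle y,q\rangle q$. $\lambda_{\max}(A)$ is the maximum of the spectrum of $A$. The subdifferential of $\lambda_{\max}:K(H)^{sa}\to\mathbb{R}$ at $A$ is $\partial\lambda_{\max}(A)=\{Y\in B_1(H)^{sa}:\lambda_{\max}(B)-\lambda_{\max}(A)\ge\mathrm{Re}\,\mathrm{tr}(Y(B-A))\ \forall B\in K(H)^{sa}\}$.
   Formalization: The equality of the subdifferential with D_{S_max} is claimed only if λ_max(A)≠0 or H is finite-dimensional; if dim H=∞ and λ_max(A)=0 it is false, since Y=0 is then a subgradient with trace 0 (e.g. A=diag(0,-1,-1/2,...)). *)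

theory Defs
  imports
    "HOL-Analysis.Analysis"
    "Jordan_Normal_Form.Schur_Decomposition"
begin

section \<open>Complex Hilbert spaces\<close>

text \<open>
  The class extends the real inner product spaces of the library: the real inner product is
  required to be the real part of the complex one, so that \<open>norm x = sqrt (Re (cinner x x))\<close>.
  The complex inner product is linear in its first argument.
\<close>

class complex_hilbert_space = real_inner + complete_space +
  fixes scaleC :: "complex \<Rightarrow> 'a \<Rightarrow> 'a" (infixr "*\<^sub>C" 75)
    and cinner :: "'a \<Rightarrow> 'a \<Rightarrow> complex"
  assumes scaleC_add_right: "a *\<^sub>C (x + y) = a *\<^sub>C x + a *\<^sub>C y"
    and scaleC_add_left: "(a + b) *\<^sub>C x = a *\<^sub>C x + b *\<^sub>C x"
    and scaleC_scaleC: "a *\<^sub>C b *\<^sub>C x = (a * b) *\<^sub>C x"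
    and scaleR_scaleC: "r *\<^sub>R x = complex_of_real r *\<^sub>C x"
    and cinner_commute: "cinner x y = cnj (cinner y x)"
    and cinner_add_left: "cinner (x + y) z = cinner x z + cinner y z"
    and cinner_scaleC_left: "cinner (a *\<^sub>C x) y = a * cinner x y"
    and inner_eq_Re_cinner: "inner x y = Re (cinner x y)"
begin

subclass banach ..

lemma scaleC_one: "1 *\<^sub>C x = x"
  by (metis scaleR_scaleC scaleR_one of_real_1)

end

global_interpretation complex_vector:
  vector_space "scaleC :: complex \<Rightarrow> 'h \<Rightarrow> 'h::complex_hilbert_space"
  by unfold_locales (simp_all add: scaleC_add_right scaleC_add_left scaleC_scaleC scaleC_one)

lemma cinner_self: "cinner x x = complex_of_real ((norm x)\<^sup>2)"
  for x :: "'h::complex_hilbert_space"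
proof (rule complex_eqI)
  show "Re (cinner x x) = Re (complex_of_real ((norm x)\<^sup>2))"
    by (simp add: inner_eq_Re_cinner[symmetric] power2_norm_eq_inner)
  have "Im (cinner x x) = - Im (cinner x x)"
    using arg_cong[OF cinner_commute[of x x], of Im] by simp
  then show "Im (cinner x x) = Im (complex_of_real ((norm x)\<^sup>2))"
    by simp
qed

lemma norm_scaleC: "norm (c *\<^sub>C x) = cmod c * norm x"
  for x :: "'h::complex_hilbert_space"
proof -
  have "cinner (c *\<^sub>C x) (c *\<^sub>C x) = c * cnj (c * cinner x x)"
    by (metis cinner_commute cinner_scaleC_left)
  also have "\<dots> = (c * cnj c) * complex_of_real ((norm x)\<^sup>2)"
    by (simp add: cinner_self)
  also have "\<dots> = complex_of_real ((cmod c * norm x)\<^sup>2)"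
    by (simp add: complex_norm_square[symmetric] power_mult_distrib)
  finally have "complex_of_real ((norm (c *\<^sub>C x))\<^sup>2) = complex_of_real ((cmod c * norm x)\<^sup>2)"
    by (simp only: cinner_self)
  then have "(norm (c *\<^sub>C x))\<^sup>2 = (cmod c * norm x)\<^sup>2"
    by (simp only: of_real_eq_iff)
  then show ?thesis
    by simp
qed

lemma Cauchy_Schwarz_cinner: "cmod (cinner x y) \<le> norm x * norm y"
  for x y :: "'h::complex_hilbert_space"
proof (cases "cinner x y = 0")
  case False
  define u where "u = cnj (sgn (cinner x y))"
  have u: "cmod u = 1"
    using False by (simp add: u_def norm_sgn)
  have "complex_of_real (cmod (cinner x y)) = u * cinner x y"
    using False
    by (simp add: u_def sgn_eq complex_norm_square[symmetric] power2_eq_square mult.commute)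
  then have "cmod (cinner x y) = Re (cinner (u *\<^sub>C x) y)"
    by (metis Re_complex_of_real cinner_scaleC_left)
  also have "\<dots> \<le> norm (u *\<^sub>C x) * norm y"
    by (metis inner_eq_Re_cinner norm_cauchy_schwarz)
  finally show ?thesis
    by (simp add: norm_scaleC u)
qed simp

lemma bounded_linear_scaleC: "bounded_linear (\<lambda>x. c *\<^sub>C x :: 'h::complex_hilbert_space)"
  by (rule bounded_linear_intro[of _ "cmod c"])
    (simp_all add: scaleC_add_right scaleR_scaleC scaleC_scaleC norm_scaleC mult.commute)

lemma bounded_linear_scaleC_left:
  "bounded_linear (\<lambda>c. c *\<^sub>C (x :: 'h::complex_hilbert_space))"
  by (rule bounded_linear_intro[of _ "norm x"])
    (simp_all add: scaleC_add_left scaleR_scaleC scaleC_scaleC norm_scaleC scaleR_conv_of_real)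

lemma bounded_linear_cinner_left:
  "bounded_linear (\<lambda>x. cinner x (y :: 'h::complex_hilbert_space))"
  by (rule bounded_linear_intro[of _ "norm y"])
    (simp_all add: cinner_add_left scaleR_scaleC cinner_scaleC_left scaleR_conv_of_real
      Cauchy_Schwarz_cinner)

definition orthonormal :: "'h::complex_hilbert_space set \<Rightarrow> bool" where
  "orthonormal E \<longleftrightarrow>
    (\<forall>e\<in>E. norm e = 1) \<and> (\<forall>e\<in>E. \<forall>f\<in>E. e \<noteq> f \<longrightarrow> cinner e f = 0)"

definition orthonormal_basis ::
  "'h::complex_hilbert_space set \<Rightarrow> 'h set \<Rightarrow> bool" where
  "orthonormal_basis E V \<longleftrightarrow> orthonormal E \<and> closure (complex_vector.span E) = V"


section \<open>Operators\<close>

text \<open>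
  The type \<open>'h \<Rightarrow>\<^sub>L 'h\<close> with its operator norm consists of the bounded \<open>real\<close>-linear maps.
  The bounded operators of the complex Hilbert space are the members that satisfy the
  following predicate.
\<close>

definition complex_linear :: "('h::complex_hilbert_space \<Rightarrow>\<^sub>L 'h) \<Rightarrow> bool" where
  "complex_linear T \<longleftrightarrow> (\<forall>c x. T (c *\<^sub>C x) = c *\<^sub>C T x)"

definition is_adjoint ::
  "('h::complex_hilbert_space \<Rightarrow>\<^sub>L 'h) \<Rightarrow> ('h \<Rightarrow>\<^sub>L 'h) \<Rightarrow> bool" where
  "is_adjoint T S \<longleftrightarrow> (\<forall>x y. cinner (T x) y = cinner x (S y))"

definition self_adjoint :: "('h::complex_hilbert_space \<Rightarrow>\<^sub>L 'h) \<Rightarrow> bool" where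
  "self_adjoint T \<longleftrightarrow> is_adjoint T T"

definition positive_op :: "('h::complex_hilbert_space \<Rightarrow>\<^sub>L 'h) \<Rightarrow> bool" where
  "positive_op T \<longleftrightarrow> self_adjoint T \<and> (\<forall>x. 0 \<le> Re (cinner (T x) x))"

definition compact_op :: "('h::complex_hilbert_space \<Rightarrow>\<^sub>L 'h) \<Rightarrow> bool" where
  "compact_op T \<longleftrightarrow> compact (closure (blinfun_apply T ` cball 0 1))"

definition compact_sa :: "('h::complex_hilbert_space \<Rightarrow>\<^sub>L 'h) set" where
  "compact_sa = {T. complex_linear T \<and> self_adjoint T \<and> compact_op T}"

text \<open>
  \<open>T\<close> is of trace class if the trace of \<open>\<bar>T\<bar>\<close> is finite; below, \<open>P\<close> is \<open>\<bar>T\<bar>\<close>, the positive square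
  root of \<open>T\<^sup>* T\<close>. It exists and is unique for every bounded \<open>T\<close>.
\<close>

definition trace_class :: "('h::complex_hilbert_space \<Rightarrow>\<^sub>L 'h) \<Rightarrow> bool" where
  "trace_class T \<longleftrightarrow> complex_linear T \<and>
    (\<exists>S P. is_adjoint T S \<and> complex_linear P \<and> positive_op P \<and> P o\<^sub>L P = S o\<^sub>L T \<and>
      (\<forall>E. orthonormal_basis E UNIV \<longrightarrow> (\<lambda>e. Re (cinner (P e) e)) summable_on E))"

definition trace_class_sa :: "('h::complex_hilbert_space \<Rightarrow>\<^sub>L 'h) set" where
  "trace_class_sa = {T. trace_class T \<and> self_adjoint T}"

text \<open>
  For a trace class operator the sum converges absolutely and does not depend on the chosen
  orthonormal basis of the Hilbert space.
\<close>

definition op_trace :: "('h::complex_hilbert_space \<Rightarrow>\<^sub>L 'h) \<Rightarrow> complex" where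
  "op_trace T = (\<Sum>\<^sub>\<infinity>e\<in>(SOME E. orthonormal_basis E UNIV). cinner (T e) e)"

lift_definition scalar_op :: "complex \<Rightarrow> 'h::complex_hilbert_space \<Rightarrow>\<^sub>L 'h"
  is "\<lambda>c x. c *\<^sub>C x"
  by (rule bounded_linear_scaleC)

definition op_spectrum :: "('h::complex_hilbert_space \<Rightarrow>\<^sub>L 'h) \<Rightarrow> complex set" where
  "op_spectrum T = {z. \<not> (\<exists>S. complex_linear S \<and>
    S o\<^sub>L (T - scalar_op z) = id_blinfun \<and> (T - scalar_op z) o\<^sub>L S = id_blinfun)}"

text \<open>The spectrum of a self-adjoint operator is real, so its maximum is taken over the reals.\<close>

definition lambda_max :: "('h::complex_hilbert_space \<Rightarrow>\<^sub>L 'h) \<Rightarrow> real" where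
  "lambda_max T = (GREATEST r. complex_of_real r \<in> op_spectrum T)"

definition eigenspace :: "('h::complex_hilbert_space \<Rightarrow>\<^sub>L 'h) \<Rightarrow> real \<Rightarrow> 'h set" where
  "eigenspace T r = {x. T x = complex_of_real r *\<^sub>C x}"

text \<open>
  Every operator on an infinite-dimensional space has \<open>0\<close> in its spectrum if it is compact. On such
  a space \<open>lambda_max\<close> is therefore nonnegative on \<^const>\<open>compact_sa\<close>, and the zero operator is a
  subgradient at each \<open>A\<close> with \<open>lambda_max A = 0\<close>; density operators are not the only ones there.

  \<open>dim\<close> is \<open>0\<close> for an infinite-dimensional eigenspace, so a positive value of the following
  multiplicity means that the eigenspace is finite-dimensional.
\<close>

definition eigen_mult :: "('h::complex_hilbert_space \<Rightarrow>\<^sub>L 'h) \<Rightarrow> real \<Rightarrow> nat" where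
  "eigen_mult T r = complex_vector.dim (eigenspace T r)"

text \<open>The operator \<open>q q\<^sup>*\<close>.\<close>

lift_definition rank_one :: "'h::complex_hilbert_space \<Rightarrow> 'h \<Rightarrow>\<^sub>L 'h"
  is "\<lambda>q y. cinner y q *\<^sub>C q"
  by (rule bounded_linear_compose[OF bounded_linear_scaleC_left bounded_linear_cinner_left])

definition orth_proj :: "'h::complex_hilbert_space set \<Rightarrow> 'h \<Rightarrow>\<^sub>L 'h" where
  "orth_proj V = (THE P :: 'h \<Rightarrow>\<^sub>L 'h. \<forall>x. P x \<in> V \<and> (\<forall>v\<in>V. cinner (x - P x) v = 0))"

definition subdifferential ::
  "(('h::complex_hilbert_space \<Rightarrow>\<^sub>L 'h) \<Rightarrow> real) \<Rightarrow> ('h \<Rightarrow>\<^sub>L 'h) \<Rightarrow> ('h \<Rightarrow>\<^sub>L 'h) set" where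
  "subdifferential f A =
    {Y \<in> trace_class_sa. \<forall>B\<in>compact_sa. f B - f A \<ge> Re (op_trace (Y o\<^sub>L (B - A)))}"

definition D_Smax ::
  "('h::complex_hilbert_space \<Rightarrow>\<^sub>L 'h) \<Rightarrow> ('h \<Rightarrow>\<^sub>L 'h) set" where
  "D_Smax A = convex hull {rank_one q |q. q \<in> eigenspace A (lambda_max A) \<and> norm q = 1}"


section \<open>Matrices and operators with finitely many columns\<close>

text \<open>\<open>\<bullet>c\<close> conjugates its second argument, so the last conjunct says \<open>v\<^sup>* R v \<ge> 0\<close>.\<close>

definition density_matrices :: "nat \<Rightarrow> complex mat set" where
  "density_matrices s = {R \<in> carrier_mat s s. mat_adjoint R = R \<and> (\<Sum>i<s. R $$ (i, i)) = 1 \<and>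
    (\<forall>v\<in>carrier_vec s. 0 \<le> Re ((R *\<^sub>v v) \<bullet>c v))}"

text \<open>
  A family \<open>q 0, \<dots>, q (s - 1)\<close> of vectors is regarded as the operator with these columns, which
  maps a coordinate vector of dimension \<open>s\<close> into the Hilbert space. The second map is its adjoint.
\<close>

definition columns_op ::
  "nat \<Rightarrow> (nat \<Rightarrow> 'h::complex_hilbert_space) \<Rightarrow> complex vec \<Rightarrow> 'h" where
  "columns_op s q v = (\<Sum>i<s. vec_index v i *\<^sub>C q i)"

definition columns_op_adj ::
  "nat \<Rightarrow> (nat \<Rightarrow> 'h::complex_hilbert_space) \<Rightarrow> 'h \<Rightarrow> complex vec" where
  "columns_op_adj s q y = Matrix.vec s (\<lambda>i. cinner y (q i))"

lemma columns_op_adjoint: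
  fixes y :: "'h::complex_hilbert_space"
  assumes "v \<in> carrier_vec s"
  shows "cinner (columns_op s q v) y = v \<bullet>c columns_op_adj s q y"
proof -
  have sum: "cinner (sum f I) y = (\<Sum>i\<in>I. cinner (f i) y)" for f :: "nat \<Rightarrow> 'h" and I
    by (rule linear_sum[OF bounded_linear.linear[OF bounded_linear_cinner_left]])
  have "cnj (cinner y (q i)) = cinner (q i) y" for i
    by (metis cinner_commute)
  then show ?thesis
    using assms
    by (auto simp: columns_op_def columns_op_adj_def sum cinner_scaleC_left scalar_prod_def
        lessThan_atLeast0 intro!: sum.cong)
qed

text \<open>The operator \<open>Q R Q\<^sup>*\<close>.\<close>

definition sandwich ::
  "nat \<Rightarrow> (nat \<Rightarrow> 'h::complex_hilbert_space) \<Rightarrow> complex mat \<Rightarrow> 'h \<Rightarrow>\<^sub>L 'h" where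
  "sandwich s q R = Blinfun (\<lambda>y. columns_op s q (R *\<^sub>v columns_op_adj s q y))"

lemma sandwich_apply:
  assumes "R \<in> carrier_mat s s"
  shows "sandwich s q R y = columns_op s q (R *\<^sub>v columns_op_adj s q y)"
proof -
  have "columns_op s q (R *\<^sub>v columns_op_adj s q y) =
      (\<Sum>i<s. (\<Sum>j<s. R $$ (i, j) * cinner y (q j)) *\<^sub>C q i)" for y
    using assms
    by (auto simp: columns_op_def columns_op_adj_def scalar_prod_def lessThan_atLeast0
        intro!: sum.cong)
  moreover have "bounded_linear (\<lambda>y. \<Sum>i<s. (\<Sum>j<s. R $$ (i, j) * cinner y (q j)) *\<^sub>C q i)"
    by (intro bounded_linear_sum bounded_linear_compose[OF bounded_linear_scaleC_left]
        bounded_linear_mult_right[THEN bounded_linear_compose] bounded_linear_cinner_left)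
  ultimately show ?thesis
    by (simp add: sandwich_def bounded_linear_Blinfun_apply)
qed

end

theory Submission
  imports Defs
begin

text \<open>
  The largest spectral value of a self-adjoint operator is the supremum of its quadratic form on the
  unit sphere. A unit eigenvector \<open>q\<close> of \<open>\<lambda> = lambda_max A\<close> therefore gives the subgradient \<open>q q\<^sup>*\<close>, and
  so does every convex combination of such operators.

  Conversely, a subgradient \<open>Y\<close> need only be tested against finite rank perturbations of \<open>A\<close>.
  Subtracting \<open>x x\<^sup>*\<close> does not raise \<open>\<lambda>\<close>, so \<open>Y\<close> is positive; adding a finite rank projection
  raises \<open>\<lambda>\<close> by at most 1, so the trace of \<open>Y\<close> on every finite orthonormal set is at most 1. If
  \<open>\<lambda> \<noteq> 0\<close> or the space is finite-dimensional, compactness gives a gap between \<open>\<lambda>\<close> and the quadratic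
  form on the complement of the eigenspace, so subtracting a small multiple of \<open>E\<^sub>+\<close> lowers \<open>\<lambda>\<close> by
  that multiple. Hence the trace of \<open>Y\<close> on the eigenspace is at least 1, and \<open>Y\<close> vanishes on the
  complement. A positive operator supported on the eigenspace is a sum of rank one operators by
  diagonal Cholesky factorisation, which makes it a convex combination of the operators \<open>q q\<^sup>*\<close>.
\<close>

section \<open>Self-adjoint, compact and positive operators\<close>

lemma cinner_zero_left [simp]: "cinner 0 (y :: 'h::complex_hilbert_space) = 0"
  by (metis bounded_linear_cinner_left linear_simps(3))

lemma cinner_minus_left: "cinner (- x) y = - cinner x (y :: 'h::complex_hilbert_space)"
  by (metis bounded_linear_cinner_left linear_simps(4))

lemma cinner_diff_left: "cinner (x - z) y = cinner x y - cinner z (y :: 'h::complex_hilbert_space)"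
  by (metis bounded_linear_cinner_left linear_simps(2))

lemma cinner_sum_left: "cinner (sum f I) y = (\<Sum>i\<in>I. cinner (f i) (y :: 'h::complex_hilbert_space))"
  by (rule linear_sum[OF bounded_linear.linear[OF bounded_linear_cinner_left]])

lemma cinner_zero_right [simp]: "cinner (y :: 'h::complex_hilbert_space) 0 = 0"
  by (metis cinner_commute cinner_zero_left complex_cnj_zero)

lemma cinner_add_right: "cinner y (x + z) = cinner y x + cinner y (z :: 'h::complex_hilbert_space)"
  by (metis cinner_commute cinner_add_left complex_cnj_add)

lemma cinner_minus_right: "cinner y (- x) = - cinner y (x :: 'h::complex_hilbert_space)"
  by (metis cinner_commute cinner_minus_left complex_cnj_minus)

lemma cinner_diff_right: "cinner y (x - z) = cinner y x - cinner y (z :: 'h::complex_hilbert_space)"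
  by (metis cinner_commute cinner_diff_left complex_cnj_diff)

lemma cinner_scaleC_right: "cinner y (a *\<^sub>C x) = cnj a * cinner y (x :: 'h::complex_hilbert_space)"
  by (metis cinner_commute cinner_scaleC_left complex_cnj_mult)

lemma cinner_sum_right: "cinner y (sum f I) = (\<Sum>i\<in>I. cinner y (f i :: 'h::complex_hilbert_space))"
proof -
  have "cinner y (sum f I) = cnj (cinner (sum f I) y)"
    by (rule cinner_commute)
  also have "\<dots> = (\<Sum>i\<in>I. cnj (cinner (f i) y))"
    by (simp add: cinner_sum_left)
  also have "\<dots> = (\<Sum>i\<in>I. cinner y (f i))"
    by (intro sum.cong refl cinner_commute[symmetric])
  finally show ?thesis .
qed

lemma cinner_scaleR_left: "cinner (r *\<^sub>R x) y = of_real r * cinner x (y :: 'h::complex_hilbert_space)"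
  by (simp add: scaleR_scaleC cinner_scaleC_left)

lemma cinner_scaleR_right: "cinner y (r *\<^sub>R x) = of_real r * cinner y (x :: 'h::complex_hilbert_space)"
  by (simp add: scaleR_scaleC cinner_scaleC_right)

lemmas cinner_simps =
  cinner_add_left cinner_diff_left cinner_minus_left cinner_scaleC_left cinner_scaleR_left
  cinner_add_right cinner_diff_right cinner_minus_right cinner_scaleC_right cinner_scaleR_right

lemma self_adjointD: "self_adjoint T \<Longrightarrow> cinner (T x) y = cinner x (T y)"
  by (simp add: self_adjoint_def is_adjoint_def)

lemma self_adjoint_inner: "self_adjoint T \<Longrightarrow> inner (T x) y = inner x (T y)"
  by (simp add: inner_eq_Re_cinner self_adjointD)

lemma self_adjoint_Re: "self_adjoint T \<Longrightarrow> complex_of_real (Re (cinner (T x) x)) = cinner (T x) x"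
  by (metis Reals_cnj_iff cinner_commute of_real_Re self_adjointD)

lemma rank_one_apply [simp]: "rank_one q y = cinner y q *\<^sub>C q"
  by (simp add: rank_one.rep_eq)

lemma scalar_op_apply [simp]: "scalar_op c y = c *\<^sub>C y"
  by (simp add: scalar_op.rep_eq)

lemma complex_linearD: "complex_linear T \<Longrightarrow> T (c *\<^sub>C x) = c *\<^sub>C T x"
  by (simp add: complex_linear_def)

lemma complex_linear_rank_one: "complex_linear (rank_one q)"
  by (simp add: complex_linear_def cinner_scaleC_left scaleC_scaleC)

lemma complex_linear_zero: "complex_linear 0"
  by (simp add: complex_linear_def)

lemma complex_linear_add: "complex_linear S \<Longrightarrow> complex_linear T \<Longrightarrow> complex_linear (S + T)"
  by (simp add: complex_linear_def blinfun.add_left scaleC_add_right)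

lemma complex_linear_scaleR: "complex_linear T \<Longrightarrow> complex_linear (r *\<^sub>R T)"
  by (simp add: complex_linear_def blinfun.scaleR_left scaleR_scaleC scaleC_scaleC mult.commute)

lemma self_adjoint_rank_one: "self_adjoint (rank_one q)"
  unfolding self_adjoint_def is_adjoint_def
  by (metis cinner_commute cinner_scaleC_left cinner_scaleC_right mult.commute rank_one_apply)

lemma self_adjoint_zero: "self_adjoint 0"
  by (simp add: self_adjoint_def is_adjoint_def)

lemma self_adjoint_add: "self_adjoint S \<Longrightarrow> self_adjoint T \<Longrightarrow> self_adjoint (S + T)"
  by (simp add: self_adjoint_def is_adjoint_def blinfun.add_left cinner_simps)

lemma self_adjoint_scaleR: "self_adjoint T \<Longrightarrow> self_adjoint (r *\<^sub>R T)"
  by (simp add: self_adjoint_def is_adjoint_def blinfun.scaleR_left cinner_simps)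

text \<open>Containment in some compact set passes through sums and multiples more easily than
  compactness of the closed image.\<close>

lemma compact_op_iff: "compact_op T \<longleftrightarrow> (\<exists>C. compact C \<and> blinfun_apply T ` cball 0 1 \<subseteq> C)"
proof
  assume "\<exists>C. compact C \<and> blinfun_apply T ` cball 0 1 \<subseteq> C"
  then obtain C where C: "compact C" "blinfun_apply T ` cball 0 1 \<subseteq> C"
    by blast
  then have "closure (blinfun_apply T ` cball 0 1) \<subseteq> C"
    by (simp add: closure_minimal compact_imp_closed)
  then show "compact_op T"
    unfolding compact_op_def
    using closed_Int_compact[OF closed_closure C(1)] by (metis Int_absorb2)
next
  assume "compact_op T"
  then show "\<exists>C. compact C \<and> blinfun_apply T ` cball 0 1 \<subseteq> C"
    unfolding compact_op_def by (intro exI[of _ "closure (blinfun_apply T ` cball 0 1)"] conjI closure_subset)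
qed

lemma compact_op_zero: "compact_op 0"
  unfolding compact_op_iff by (intro exI[of _ "{0}"]) auto

lemma compact_op_rank_one: "compact_op (rank_one q)"
  unfolding compact_op_iff
proof (intro exI conjI)
  show "compact ((\<lambda>c. c *\<^sub>C q) ` cball 0 (norm q))"
    by (intro compact_continuous_image compact_cball linear_continuous_on
        bounded_linear_scaleC_left)
  show "blinfun_apply (rank_one q) ` cball 0 1 \<subseteq> (\<lambda>c. c *\<^sub>C q) ` cball 0 (norm q)"
  proof clarsimp
    fix x :: 'a
    assume "norm x \<le> 1"
    then have "cmod (cinner x q) \<le> norm q"
      by (metis Cauchy_Schwarz_cinner mult.commute mult_left_le norm_ge_zero order_trans)
    then show "cinner x q *\<^sub>C q \<in> (\<lambda>c. c *\<^sub>C q) ` cball 0 (norm q)"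
      by auto
  qed
qed

lemma compact_op_add:
  assumes "compact_op S" and "compact_op T"
  shows "compact_op (S + T)"
proof -
  obtain C D where C: "compact C" "blinfun_apply S ` cball 0 1 \<subseteq> C"
    and D: "compact D" "blinfun_apply T ` cball 0 1 \<subseteq> D"
    using assms unfolding compact_op_iff by blast
  have "blinfun_apply (S + T) ` cball 0 1 \<subseteq> {x + y |x y. x \<in> C \<and> y \<in> D}"
    using C(2) D(2) by (fastforce simp: blinfun.add_left)
  then show ?thesis
    unfolding compact_op_iff using compact_sums[OF C(1) D(1)] by blast
qed

lemma compact_op_scaleR: 
  assumes "compact_op T"
  shows "compact_op (r *\<^sub>R T)"
proof -
  obtain C where C: "compact C" "blinfun_apply T ` cball 0 1 \<subseteq> C"
    using assms unfolding compact_op_iff by blast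
  then have "blinfun_apply (r *\<^sub>R T) ` cball 0 1 \<subseteq> (*\<^sub>R) r ` C"
    by (auto simp: blinfun.scaleR_left)
  then show ?thesis
    unfolding compact_op_iff using compact_scaling[OF C(1)] by blast
qed

lemma compact_sa_zero: "0 \<in> compact_sa"
  by (simp add: compact_sa_def complex_linear_zero self_adjoint_zero compact_op_zero)

lemma compact_sa_add: "S \<in> compact_sa \<Longrightarrow> T \<in> compact_sa \<Longrightarrow> S + T \<in> compact_sa"
  by (simp add: compact_sa_def complex_linear_add self_adjoint_add compact_op_add)

lemma compact_sa_scaleR: "T \<in> compact_sa \<Longrightarrow> r *\<^sub>R T \<in> compact_sa"
  by (simp add: compact_sa_def complex_linear_scaleR self_adjoint_scaleR compact_op_scaleR)

lemma compact_sa_rank_one: "rank_one q \<in> compact_sa"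
  by (simp add: compact_sa_def complex_linear_rank_one self_adjoint_rank_one compact_op_rank_one)

lemma compact_sa_sum: "(\<And>i. i \<in> I \<Longrightarrow> f i \<in> compact_sa) \<Longrightarrow> sum f I \<in> compact_sa"
  by (induction I rule: infinite_finite_induct) (auto simp: compact_sa_zero compact_sa_add)

text \<open>The form is nonnegative at the damped gradient step
  \<open>x - (1 / C) *\<^sub>R P x\<close>; the summand 1 in \<open>C = norm P + 1\<close> covers
  \<open>P = 0\<close>. A small value of the form thus forces \<open>P x\<close> to be small, which
  serves the spectrum, the gap and the kernel of a subgradient.\<close>

lemma positive_op_norm_square_le:
  assumes "positive_op P"
  shows "(norm (P x))\<^sup>2 \<le> (norm P + 1) * Re (cinner (P x) x)"
proof -
  define C where "C = norm P + 1"
  have C: "C > 0"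
    by (simp add: C_def add_nonneg_pos)
  have sa: "self_adjoint P" and pos: "\<And>y. 0 \<le> inner (P y) y"
    using assms by (auto simp: positive_op_def inner_eq_Re_cinner)
  let ?y = "x - (1 / C) *\<^sub>R P x"
  have "inner (P (P x)) (P x) \<le> norm (P (P x)) * norm (P x)"
    by (rule norm_cauchy_schwarz)
  also have "\<dots> \<le> (norm P * norm (P x)) * norm (P x)"
    by (intro mult_right_mono norm_blinfun norm_ge_zero)
  also have "\<dots> \<le> C * (norm (P x))\<^sup>2"
    by (simp add: C_def power2_eq_square mult_right_mono algebra_simps)
  finally have le: "inner (P (P x)) (P x) \<le> C * (norm (P x))\<^sup>2" .
  have "0 \<le> inner (P ?y) ?y"
    by (rule pos)
  also have "\<dots> = inner (P x) x - (2 / C) * (norm (P x))\<^sup>2 + (1 / C)\<^sup>2 * inner (P (P x)) (P x)"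
    using self_adjoint_inner[OF sa, of "P x" x]
    by (simp add: blinfun.diff_right blinfun.scaleR_right inner_diff_left inner_diff_right
        power2_norm_eq_inner power2_eq_square[of "1 / C"] algebra_simps)
  also have "\<dots> \<le> inner (P x) x - (2 / C) * (norm (P x))\<^sup>2 + (1 / C)\<^sup>2 * (C * (norm (P x))\<^sup>2)"
    by (intro add_left_mono mult_left_mono le) simp
  also have "\<dots> = inner (P x) x - (norm (P x))\<^sup>2 / C"
    using C by (simp add: power2_eq_square field_simps)
  finally show ?thesis
    unfolding C_def[symmetric] using C by (simp add: inner_eq_Re_cinner field_simps)
qed

lemma positive_op_eq_0:
  assumes "positive_op P" and "Re (cinner (P x) x) \<le> 0"
  shows "P x = 0"
proof -
  have "Re (cinner (P x) x) = 0"
    using assms by (auto simp: positive_op_def intro: antisym)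
  then show ?thesis
    using positive_op_norm_square_le[OF assms(1), of x] by simp
qed

section \<open>The numerical range determines the largest spectral value\<close>

text \<open>Surjectivity by Banach's fixed point theorem: for small \<open>t\<close> the map \<open>x \<mapsto> x - t B x + t y\<close> is a
  contraction, and its fixed point solves \<open>B x = y\<close>.\<close>

lemma bij_of_coercive:
  fixes B :: "'h::complex_hilbert_space \<Rightarrow>\<^sub>L 'h"
  assumes c: "c > 0" and coer: "\<And>x. c * (norm x)\<^sup>2 \<le> inner (B x) x"
  shows "bij (blinfun_apply B)" and "c * norm x \<le> norm (B x)"
proof -
  have lower: "c * norm x \<le> norm (B x)" for x
  proof (cases "x = 0")
    case False
    have "(c * norm x) * norm x \<le> norm (B x) * norm x"
      using coer[of x] norm_cauchy_schwarz[of "B x" x] by (simp add: power2_eq_square)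
    then show ?thesis
      using False by simp
  qed simp
  then show "c * norm x \<le> norm (B x)" .
  \<comment> \<open>\<open>K\<close> dominates both \<open>norm B\<close> and \<open>c\<close>, so
    \<open>c / K\<close> is at most 1. The step \<open>t = c / K^2\<close> minimises
    \<open>1 - 2 t c + t^2 K^2\<close>, and the minimum is \<open>k^2\<close>.\<close>
  define K where "K = norm B + c"
  have K: "K > 0" "c \<le> K" "norm B \<le> K"
    using c by (auto simp: K_def add_nonneg_pos)
  define t where "t = c / K\<^sup>2"
  define k where "k = sqrt (1 - (c / K)\<^sup>2)"
  have k_sq: "0 \<le> 1 - (c / K)\<^sup>2" "1 - (c / K)\<^sup>2 < 1"
    using K c by (auto simp: abs_square_le_1 divide_le_eq_1)
  then have k: "0 \<le> k" "k < 1"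
    by (auto simp: k_def)
  have contr: "norm (x - t *\<^sub>R B x) \<le> k * norm x" for x
  proof -
    have "norm (B x) \<le> K * norm x"
      using norm_blinfun[of B x] mult_right_mono[OF K(3) norm_ge_zero[of x]] by linarith
    then have "(norm (B x))\<^sup>2 \<le> K\<^sup>2 * (norm x)\<^sup>2"
      by (metis norm_ge_zero power_mono power_mult_distrib)
    then have 1: "t\<^sup>2 * (norm (B x))\<^sup>2 \<le> t\<^sup>2 * (K\<^sup>2 * (norm x)\<^sup>2)"
      by (rule mult_left_mono) simp
    have 2: "2 * t * (c * (norm x)\<^sup>2) \<le> 2 * t * inner (B x) x"
      using coer[of x] c K by (intro mult_left_mono) (auto simp: t_def)
    have "(norm (x - t *\<^sub>R B x))\<^sup>2 = (norm x)\<^sup>2 - 2 * t * inner (B x) x + t\<^sup>2 * (norm (B x))\<^sup>2"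
      by (simp add: power2_norm_eq_inner inner_diff_left inner_diff_right inner_commute
          power2_eq_square[of t] algebra_simps)
    also have "\<dots> \<le> (norm x)\<^sup>2 - 2 * t * (c * (norm x)\<^sup>2) + t\<^sup>2 * (K\<^sup>2 * (norm x)\<^sup>2)"
      using 1 2 by linarith
    also have "\<dots> = (1 - (c / K)\<^sup>2) * (norm x)\<^sup>2"
      using K by (simp add: t_def power2_eq_square field_simps)
    also have "\<dots> = (k * norm x)\<^sup>2"
      by (simp only: k_def power_mult_distrib real_sqrt_pow2[OF k_sq(1)])
    finally have "(norm (x - t *\<^sub>R B x))\<^sup>2 \<le> (k * norm x)\<^sup>2" .
    then show ?thesis
      by (rule power2_le_imp_le) (use k in simp)
  qed
  have "\<exists>x. B x = y" for y
  proof -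
    define f where "f = (\<lambda>x. x - t *\<^sub>R B x + t *\<^sub>R y)"
    have "f x - f z = (x - z) - t *\<^sub>R B (x - z)" for x z
      by (simp add: f_def blinfun.diff_right algebra_simps)
    then have "\<forall>x z. dist (f x) (f z) \<le> k * dist x z"
      by (simp add: dist_norm contr)
    then obtain x where "f x = x"
      using banach_fix_type[OF k] by blast
    then have "t *\<^sub>R B x = t *\<^sub>R y"
      by (auto simp: f_def)
    then show ?thesis
      using c K by (metis divide_eq_0_iff less_irrefl power_eq_0_iff scaleR_cancel_left t_def)
  qed
  moreover have "inj (blinfun_apply B)"
  proof (rule injI)
    fix x y
    assume "B x = B y"
    then have "c * norm (x - y) \<le> 0"
      using lower[of "x - y"] by (simp add: blinfun.diff_right)
    then show "x = y"
      using c by (simp add: mult_le_0_iff)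
  qed
  ultimately show "bij (blinfun_apply B)"
    by (metis bijI surjI)
qed

text \<open>The lower bound \<open>c * norm x \<le> norm (B x)\<close> bounds the inverse by
  \<open>1 / c\<close>, and uniqueness of preimages transfers each linearity law from
  \<open>B\<close> to the inverse.\<close>

lemma coercive_inverse:
  fixes B :: "'h::complex_hilbert_space \<Rightarrow>\<^sub>L 'h"
  assumes "complex_linear B" and c: "c > 0" and coer: "\<And>x. c * (norm x)\<^sup>2 \<le> inner (B x) x"
  shows "\<exists>S. complex_linear S \<and> S o\<^sub>L B = id_blinfun \<and> B o\<^sub>L S = id_blinfun"
proof -
  have bij: "bij (blinfun_apply B)" and lower: "\<And>x. c * norm x \<le> norm (B x)"
    using bij_of_coercive[OF c coer] by auto
  define g where "g = inv_into UNIV (blinfun_apply B)"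
  have Bg: "B (g y) = y" for y
    by (simp add: g_def bij bij_is_surj surj_f_inv_f)
  have gB: "g (B x) = x" for x
    by (simp add: g_def bij bij_is_inj)
  have g_eqI: "g y = x" if "B x = y" for x y
    using gB that by blast
  have "bounded_linear g"
  proof (rule bounded_linear_intro[of _ "1 / c"])
    show "g (x + y) = g x + g y" for x y
      by (rule g_eqI) (simp add: blinfun.add_right Bg)
    show "g (r *\<^sub>R x) = r *\<^sub>R g x" for r x
      by (rule g_eqI) (simp add: blinfun.scaleR_right Bg)
    show "norm (g x) \<le> norm x * (1 / c)" for x
      using lower[of "g x"] c by (simp add: Bg field_simps)
  qed
  then have app: "Blinfun g x = g x" for x
    by (simp add: bounded_linear_Blinfun_apply)
  have "complex_linear (Blinfun g)"
    using assms(1) by (auto simp: complex_linear_def app Bg intro!: g_eqI)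
  then show ?thesis
    by (intro exI[of _ "Blinfun g"]) (auto simp: app Bg gB intro!: blinfun_eqI)
qed

context
  fixes T :: "'h::complex_hilbert_space \<Rightarrow>\<^sub>L 'h"
  assumes lin: "complex_linear T" and sa: "self_adjoint T"
begin

text \<open>For \<open>r > M\<close> the operator \<open>r - T\<close> is coercive with constant
  \<open>r - M\<close>; minus its inverse inverts \<open>T - r\<close>.\<close>

lemma not_op_spectrum_above:
  assumes "\<And>x. inner (T x) x \<le> M * (norm x)\<^sup>2" and "M < r"
  shows "complex_of_real r \<notin> op_spectrum T"
proof -
  let ?B = "scalar_op (of_real r) - T"
  have B: "?B x = r *\<^sub>R x - T x" for x
    by (simp add: blinfun.diff_left scaleR_scaleC)
  have "complex_linear ?B"
    using lin by (simp add: complex_linear_def blinfun.diff_left scaleC_scaleC mult.commute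
        complex_vector.scale_right_diff_distrib)
  moreover have "(r - M) * (norm x)\<^sup>2 \<le> inner (?B x) x" for x
    using assms(1)[of x]
    by (simp add: B inner_diff_left power2_norm_eq_inner algebra_simps)
  ultimately obtain S where S: "complex_linear S" "S o\<^sub>L ?B = id_blinfun" "?B o\<^sub>L S = id_blinfun"
    using coercive_inverse[of ?B "r - M"] \<open>M < r\<close> by auto
  have "complex_linear (- S)"
    using S(1) by (simp add: complex_linear_def blinfun.minus_left)
  moreover have "S (T x - r *\<^sub>R x) = - x" for x
    using arg_cong[OF S(2), of "\<lambda>F. blinfun_apply F x"]
    by (simp add: B blinfun.diff_right algebra_simps)
  moreover have "T (S x) - r *\<^sub>R S x = - x" for x
    using arg_cong[OF S(3), of "\<lambda>F. blinfun_apply F x"]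
    by (simp add: B algebra_simps)
  ultimately have "complex_linear (- S) \<and> - S o\<^sub>L (T - scalar_op (of_real r)) = id_blinfun \<and>
      (T - scalar_op (of_real r)) o\<^sub>L - S = id_blinfun"
    by (auto intro!: blinfun_eqI simp: blinfun.minus_left blinfun.minus_right blinfun.diff_left
        scaleR_scaleC[symmetric])
  then show ?thesis
    unfolding op_spectrum_def by blast
qed

text \<open>A left inverse \<open>S\<close> of \<open>T - M\<close> would give
  \<open>norm x \<le> norm S * norm (P x)\<close> for \<open>P = M - T\<close>. By
  \<open>positive_op_norm_square_le\<close> the form of \<open>P\<close> would then be at least a
  positive constant on the unit sphere, and the form of \<open>T\<close> could not come arbitrarily
  close to \<open>M\<close>.\<close>

lemma op_spectrum_sup:
  assumes bound: "\<And>x. inner (T x) x \<le> M * (norm x)\<^sup>2"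
    and sharp: "\<And>e. e > 0 \<Longrightarrow> \<exists>x. norm x = 1 \<and> M - e < inner (T x) x"
  shows "complex_of_real M \<in> op_spectrum T"
proof (rule ccontr)
  assume "complex_of_real M \<notin> op_spectrum T"
  then obtain S where S: "S o\<^sub>L (T - scalar_op (of_real M)) = id_blinfun"
    unfolding op_spectrum_def by blast
  define P where "P = M *\<^sub>R id_blinfun - T"
  have P: "P x = M *\<^sub>R x - T x" for x
    by (simp add: P_def blinfun.diff_left blinfun.scaleR_left)
  have "self_adjoint P"
    using sa by (simp add: self_adjoint_def is_adjoint_def P cinner_simps)
  then have "positive_op P"
    using bound by (simp add: positive_op_def P inner_eq_Re_cinner[symmetric] inner_diff_left
        power2_norm_eq_inner)
  have SP: "x = - S (P x)" for x
    using arg_cong[OF S, of "\<lambda>F. blinfun_apply F x"]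
    by (simp add: P blinfun.diff_left blinfun.diff_right scaleR_scaleC)
  define C where "C = (norm S + 1)\<^sup>2 * (norm P + 1)"
  have C: "C > 0"
    unfolding C_def by (intro mult_pos_pos zero_less_power add_nonneg_pos) auto
  have le: "(norm x)\<^sup>2 \<le> C * inner (P x) x" for x
  proof -
    have "norm x \<le> norm S * norm (P x)"
      using SP[of x] norm_blinfun[of S "P x"] by (metis norm_minus_cancel)
    also have "\<dots> \<le> (norm S + 1) * norm (P x)"
      by (intro mult_right_mono) auto
    finally have "(norm x)\<^sup>2 \<le> (norm S + 1)\<^sup>2 * (norm (P x))\<^sup>2"
      by (metis norm_ge_zero power_mono power_mult_distrib)
    also have "\<dots> \<le> (norm S + 1)\<^sup>2 * ((norm P + 1) * inner (P x) x)"
      using positive_op_norm_square_le[OF \<open>positive_op P\<close>, of x]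
      by (intro mult_left_mono) (auto simp: inner_eq_Re_cinner)
    finally show ?thesis
      by (simp add: C_def mult.assoc)
  qed
  obtain x where x: "norm x = 1" "M - 1 / C < inner (T x) x"
    using sharp[of "1 / C"] C by auto
  have "1 \<le> C * (M - inner (T x) x)"
    using le[of x] x(1) by (simp add: P inner_diff_left power2_norm_eq_inner[symmetric])
  then show False
    using x(2) C by (simp add: field_simps)
qed

text \<open>The supremum of the form on the unit sphere lies in the spectrum, and no larger real
  number does. A nonzero vector makes the sphere nonempty; on the zero space the spectrum is empty
  and has no maximum. From here on \<open>lambda_max\<close> is estimated only through these two
  inequalities.\<close>

lemma lambda_max_numerical_range:
  assumes "\<exists>x::'h. x \<noteq> 0"
  shows inner_le_lambda_max: "inner (T x) x \<le> lambda_max T * (norm x)\<^sup>2"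
    and lambda_max_le: "(\<And>x. inner (T x) x \<le> r * (norm x)\<^sup>2) \<Longrightarrow> lambda_max T \<le> r"
proof -
  define W where "W = (\<lambda>x. inner (T x) x) ` {x. norm x = 1}"
  obtain u :: 'h where "norm u = 1"
    using assms by (metis norm_sgn)
  then have ne: "W \<noteq> {}"
    by (auto simp: W_def)
  have bdd: "bdd_above W"
  proof (rule bdd_aboveI[of _ "norm T"])
    fix w
    assume "w \<in> W"
    then obtain x where x: "w = inner (T x) x" "norm x = 1"
      by (auto simp: W_def)
    have "w \<le> norm (T x) * norm x"
      unfolding x(1) by (rule norm_cauchy_schwarz)
    also have "\<dots> \<le> norm T"
      using norm_blinfun[of T x] x by simp
    finally show "w \<le> norm T" .
  qed
  have bound: "inner (T x) x \<le> Sup W * (norm x)\<^sup>2" for x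
  proof (cases "x = 0")
    case False
    then have "inner (T (sgn x)) (sgn x) \<in> W"
      by (auto simp: W_def norm_sgn)
    then have "inner (T (sgn x)) (sgn x) \<le> Sup W"
      using bdd by (rule cSup_upper)
    then show ?thesis
      using False by (simp add: sgn_div_norm blinfun.scaleR_right field_simps power2_eq_square)
  qed simp
  have "lambda_max T = Sup W"
    unfolding lambda_max_def
  proof (rule Greatest_equality)
    show "complex_of_real (Sup W) \<in> op_spectrum T"
    proof (rule op_spectrum_sup[OF bound])
      fix e :: real
      assume "e > 0"
      then have "Sup W - e < Sup W"
        by simp
      then show "\<exists>x. norm x = 1 \<and> Sup W - e < inner (T x) x"
        by (subst (asm) less_cSup_iff[OF ne bdd]) (auto simp: W_def)
    qed
    show "r \<le> Sup W" if "complex_of_real r \<in> op_spectrum T" for r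
      using not_op_spectrum_above[OF bound, of r] that by (meson not_le)
  qed
  then show "inner (T x) x \<le> lambda_max T * (norm x)\<^sup>2"
    using bound by simp
  assume r: "\<And>x. inner (T x) x \<le> r * (norm x)\<^sup>2"
  have "Sup W \<le> r"
  proof (rule cSup_least[OF ne])
    fix w
    assume "w \<in> W"
    then obtain x where "w = inner (T x) x" "norm x = 1"
      by (auto simp: W_def)
    then show "w \<le> r"
      using r[of x] by simp
  qed
  then show "lambda_max T \<le> r"
    using \<open>lambda_max T = Sup W\<close> by simp
qed

end

section \<open>Orthonormal bases and traces of finite rank operators\<close>

text \<open>For finite orthonormal \<open>Q\<close> this is the orthogonal projection onto the span.
  Orthonormality is left out so that \<open>fin_proj {x}\<close> is \<open>rank_one x\<close> for a
  vector of any length, as one of the subgradient tests requires.\<close>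

definition fin_proj :: "'h::complex_hilbert_space set \<Rightarrow> 'h \<Rightarrow>\<^sub>L 'h" where
  "fin_proj Q = (\<Sum>q\<in>Q. rank_one q)"

lemma fin_proj_apply: "fin_proj Q x = (\<Sum>q\<in>Q. cinner x q *\<^sub>C q)"
  by (simp add: fin_proj_def blinfun.sum_left)

lemma fin_proj_in_span: "fin_proj Q x \<in> complex_vector.span Q"
  unfolding fin_proj_apply
  by (intro complex_vector.span_sum complex_vector.span_scale complex_vector.span_base)

lemma fin_proj_compact_sa: "fin_proj Q \<in> compact_sa"
  unfolding fin_proj_def by (intro compact_sa_sum compact_sa_rank_one)

lemma fin_proj_complex_linear: "complex_linear (fin_proj Q)"
  and fin_proj_self_adjoint: "self_adjoint (fin_proj Q)"
  using fin_proj_compact_sa[of Q] by (auto simp: compact_sa_def)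

lemma cinner_fin_proj_left: "cinner (fin_proj Q x) y = (\<Sum>q\<in>Q. cinner x q * cinner q y)"
  by (simp add: fin_proj_apply cinner_sum_left cinner_scaleC_left)

lemma orthonormal_cinner:
  "orthonormal Q \<Longrightarrow> p \<in> Q \<Longrightarrow> q \<in> Q \<Longrightarrow> cinner p q = (if p = q then 1 else 0)"
  by (auto simp: orthonormal_def cinner_self)

lemma orthonormal_subset: "orthonormal E \<Longrightarrow> F \<subseteq> E \<Longrightarrow> orthonormal F"
  by (auto simp: orthonormal_def)

context
  fixes Q :: "'h::complex_hilbert_space set"
  assumes fin: "finite Q" and on: "orthonormal Q"
begin

lemma fin_proj_basis:
  assumes "p \<in> Q"
  shows "fin_proj Q p = p"
proof -
  have "fin_proj Q p = (\<Sum>q\<in>Q. if q = p then p else 0)"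
    unfolding fin_proj_apply
    by (intro sum.cong refl) (auto simp: orthonormal_cinner[OF on assms] scaleC_one)
  then show ?thesis
    using assms fin by simp
qed

lemma fin_proj_span_iff: "fin_proj Q x = x \<longleftrightarrow> x \<in> complex_vector.span Q"
proof
  assume "x \<in> complex_vector.span Q"
  then show "fin_proj Q x = x"
    by (induction rule: complex_vector.span_induct_alt)
      (simp_all add: blinfun.add_right complex_linearD[OF fin_proj_complex_linear] fin_proj_basis)
qed (metis fin_proj_in_span)

lemma fin_proj_idem: "fin_proj Q (fin_proj Q x) = fin_proj Q x"
  by (simp add: fin_proj_span_iff fin_proj_in_span)

lemma fin_proj_residual_orthogonal:
  assumes "z \<in> complex_vector.span Q"
  shows "cinner (x - fin_proj Q x) z = 0"
proof -
  have "cinner (fin_proj Q x) z = cinner x z"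
    using assms self_adjointD[OF fin_proj_self_adjoint, of Q x z] by (metis fin_proj_span_iff)
  then show ?thesis
    by (simp add: cinner_diff_left)
qed

lemma pythagoras_fin_proj: "(norm x)\<^sup>2 = (norm (fin_proj Q x))\<^sup>2 + (norm (x - fin_proj Q x))\<^sup>2"
proof -
  have "inner (x - fin_proj Q x) (fin_proj Q x) = 0"
    using fin_proj_residual_orthogonal[OF fin_proj_in_span, of x x] by (simp add: inner_eq_Re_cinner)
  then show ?thesis
    by (simp add: power2_norm_eq_inner inner_diff_left inner_diff_right inner_commute)
qed

text \<open>If the projection fixes \<open>z\<close>, then \<open>x\<close> and \<open>x - z\<close>
  have the same residual, and by Pythagoras a residual is no longer than its vector.\<close>

lemma fin_proj_nearest:
  assumes "z \<in> complex_vector.span Q"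
  shows "norm (x - fin_proj Q x) \<le> norm (x - z)"
proof -
  have "(norm (x - fin_proj Q x))\<^sup>2 \<le> (norm (x - z))\<^sup>2"
    using pythagoras_fin_proj[of "x - z"] assms
    by (simp add: blinfun.diff_right fin_proj_span_iff[symmetric])
  then show ?thesis
    by (rule power2_le_imp_le) simp
qed

lemma norm_fin_proj_le: "norm (fin_proj Q x) \<le> norm x"
  by (rule power2_le_imp_le) (simp_all add: pythagoras_fin_proj[of x])

text \<open>The normalised residual of \<open>x\<close> is the only vector that may have to be
  added. The upper bound on \<open>Q'\<close> keeps the span of a finite set unchanged; the other
  two properties also drive an increasing chain along a dense sequence.\<close>

lemma gram_schmidt_step:
  "\<exists>Q'. finite Q' \<and> orthonormal Q' \<and> Q \<subseteq> Q' \<and> Q' \<subseteq> complex_vector.span (insert x Q) \<and>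
    x \<in> complex_vector.span Q'"
proof (cases "x \<in> complex_vector.span Q")
  case True
  then show ?thesis
    using fin on by (intro exI[of _ Q]) (auto intro: complex_vector.span_base)
next
  case False
  define z where "z = x - fin_proj Q x"
  define u where "u = complex_of_real (1 / norm z) *\<^sub>C z"
  have "z \<noteq> 0"
    using False fin_proj_in_span[of Q x] by (auto simp: z_def)
  then have "norm u = 1"
    by (simp add: u_def norm_scaleC norm_divide)
  have xu: "x = complex_of_real (norm z) *\<^sub>C u + fin_proj Q x"
    using \<open>z \<noteq> 0\<close> by (simp add: u_def z_def scaleC_scaleC scaleC_one)
  have orth: "cinner u q = 0" "cinner q u = 0" if "q \<in> Q" for q
  proof -
    show "cinner u q = 0"
      using fin_proj_residual_orthogonal[OF complex_vector.span_base[OF that], of x]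
      by (simp add: u_def z_def[symmetric] cinner_scaleC_left)
    then show "cinner q u = 0"
      by (metis cinner_commute complex_cnj_zero)
  qed
  have "orthonormal (insert u Q)"
    using on orth \<open>norm u = 1\<close> by (auto simp: orthonormal_def)
  moreover have "u \<in> complex_vector.span (insert x Q)"
    unfolding u_def z_def
    using fin_proj_in_span[of Q x] complex_vector.span_mono[of Q "insert x Q"]
    by (intro complex_vector.span_scale complex_vector.span_diff)
      (auto intro: complex_vector.span_base)
  moreover have "x \<in> complex_vector.span (insert u Q)"
    by (subst xu, intro complex_vector.span_add complex_vector.span_scale)
      (use fin_proj_in_span[of Q x] complex_vector.span_mono[of Q "insert u Q"] in
        \<open>auto intro: complex_vector.span_base\<close>)
  ultimately show ?thesis
    using fin by (intro exI[of _ "insert u Q"]) (auto intro: complex_vector.span_base)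
qed

end

section \<open>Existence of orthonormal bases and Parseval's identity\<close>

lemma orthonormal_empty: "orthonormal {}"
  by (simp add: orthonormal_def)

lemma finite_orthonormal_span:
  fixes b :: "'h::complex_hilbert_space set"
  assumes "finite b"
  shows "\<exists>Q. finite Q \<and> orthonormal Q \<and> complex_vector.span Q = complex_vector.span b"
  using assms
proof (induction b)
  case empty
  then show ?case
    by (intro exI[of _ "{}"]) (simp add: orthonormal_empty)
next
  case (insert x b)
  then obtain Q where Q: "finite Q" "orthonormal Q" "complex_vector.span Q = complex_vector.span b"
    by blast
  obtain Q' where Q': "finite Q'" "orthonormal Q'" "Q \<subseteq> Q'"
      "Q' \<subseteq> complex_vector.span (insert x Q)" "x \<in> complex_vector.span Q'"
    using gram_schmidt_step[OF Q(1,2), of x] by blast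
  have eq: "complex_vector.span (insert x Q) = complex_vector.span (insert x b)"
    using Q(3) by (simp add: complex_vector.span_insert)
  have "complex_vector.span Q' = complex_vector.span (insert x Q)"
  proof
    show "complex_vector.span Q' \<subseteq> complex_vector.span (insert x Q)"
      using Q'(4) by (simp add: complex_vector.span_minimal)
    show "complex_vector.span (insert x Q) \<subseteq> complex_vector.span Q'"
      using Q'(3,5) by (intro complex_vector.span_minimal) (auto intro: complex_vector.span_base)
  qed
  then show ?case
    using Q' eq by auto
qed

text \<open>\<open>op_trace\<close> picks its basis by \<open>SOME\<close>, so existence has to be
  known. Gram-Schmidt along a dense sequence yields an increasing chain of finite orthonormal sets;
  any two vectors of the union lie in a common stage, and the span of the union contains the dense
  sequence.\<close>

lemma orthonormal_basis_exists:
  assumes "separable_space (euclidean :: 'h::complex_hilbert_space topology)"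
  shows "\<exists>E :: 'h set. orthonormal_basis E UNIV"
proof -
  obtain C :: "'h set" where C: "countable C" "closure C = UNIV"
    using assms unfolding separable_space_def by auto
  then have "C \<noteq> {}"
    by auto
  define d where "d = from_nat_into C"
  have d: "range d = C"
    unfolding d_def using C(1) \<open>C \<noteq> {}\<close> by (rule range_from_nat_into[rotated])
  have "\<exists>f. \<forall>n. (finite (f n) \<and> orthonormal (f n)) \<and>
      f n \<subseteq> f (Suc n) \<and> d n \<in> complex_vector.span (f (Suc n))"
  proof (rule dependent_nat_choice)
    show "\<exists>Q. finite Q \<and> orthonormal (Q :: 'h set)"
      using orthonormal_empty by blast
    show "\<exists>Q'. (finite Q' \<and> orthonormal Q') \<and> Q \<subseteq> Q' \<and> d n \<in> complex_vector.span Q'"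
      if "finite Q \<and> orthonormal Q" for Q n
      using gram_schmidt_step[of Q "d n"] that by blast
  qed
  then obtain f where f: "\<And>n. finite (f n) \<and> orthonormal (f n)"
    "\<And>n. f n \<subseteq> f (Suc n) \<and> d n \<in> complex_vector.span (f (Suc n))"
    by metis
  have mono: "f m \<subseteq> f n" if "m \<le> n" for m n
    using lift_Suc_mono_le[of f, OF _ that] f(2) by blast
  define E where "E = (\<Union>n. f n)"
  have "orthonormal E"
    unfolding orthonormal_def
  proof (intro conjI ballI impI)
    fix e
    assume "e \<in> E"
    then show "norm e = 1"
      using f(1) by (auto simp: E_def orthonormal_def)
  next
    fix e e'
    assume "e \<in> E" "e' \<in> E" "e \<noteq> e'"
    then obtain m n where "e \<in> f m" "e' \<in> f n"
      by (auto simp: E_def)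
    then have "e \<in> f (max m n)" "e' \<in> f (max m n)"
      using mono[of m "max m n"] mono[of n "max m n"] by auto
    then show "cinner e e' = 0"
      using f(1) \<open>e \<noteq> e'\<close> by (auto simp: orthonormal_def)
  qed
  moreover have "C \<subseteq> complex_vector.span E"
  proof -
    have "d n \<in> complex_vector.span E" for n
      using f(2)[of n] complex_vector.span_mono[of "f (Suc n)" E] by (auto simp: E_def)
    then show ?thesis
      using d by auto
  qed
  then have "closure (complex_vector.span E) = UNIV"
    using closure_mono[of C "complex_vector.span E"] C(2) by auto
  ultimately show ?thesis
    unfolding orthonormal_basis_def by blast
qed

lemma span_finite_subset:
  fixes E :: "'h::complex_hilbert_space set"
  assumes "z \<in> complex_vector.span E"
  shows "\<exists>F. finite F \<and> F \<subseteq> E \<and> z \<in> complex_vector.span F"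
  using assms unfolding complex_vector.span_explicit
  by (blast intro: complex_vector.span_sum complex_vector.span_scale complex_vector.span_base)

text \<open>Some finite \<open>F0\<close> spans a vector \<open>z\<close> close to \<open>x\<close>.
  For every finite \<open>F\<close> between \<open>F0\<close> and \<open>E\<close> the projection
  onto its span is at least as close, and Cauchy-Schwarz turns the residual into the error of the
  partial sum.\<close>

lemma parseval_has_sum:
  fixes x y :: "'h::complex_hilbert_space"
  assumes "orthonormal_basis E UNIV"
  shows "((\<lambda>e. cinner x e * cinner e y) has_sum cinner x y) E"
  unfolding has_sum_def tendsto_iff
proof (intro allI impI)
  fix r :: real
  assume "r > 0"
  have on: "orthonormal E" and cl: "closure (complex_vector.span E) = UNIV"
    using assms by (auto simp: orthonormal_basis_def)
  \<comment> \<open>The summand 1 keeps the denominator positive for \<open>y = 0\<close> and makes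
    the final estimate strict.\<close>
  define \<delta> where "\<delta> = r / (norm y + 1)"
  have "\<delta> > 0"
    using \<open>r > 0\<close> by (simp add: \<delta>_def add_nonneg_pos)
  then obtain z where z: "z \<in> complex_vector.span E" "norm (x - z) < \<delta>"
    using cl closure_approachable[of x "complex_vector.span E"]
    by (metis UNIV_I dist_commute dist_norm)
  then obtain F0 where F0: "finite F0" "F0 \<subseteq> E" "z \<in> complex_vector.span F0"
    using span_finite_subset by blast
  show "\<forall>\<^sub>F F in finite_subsets_at_top E. dist (\<Sum>e\<in>F. cinner x e * cinner e y) (cinner x y) < r"
    unfolding eventually_finite_subsets_at_top
  proof (intro exI conjI allI impI)
    fix F
    assume F: "finite F \<and> F0 \<subseteq> F \<and> F \<subseteq> E"
    then have "orthonormal F"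
      using on orthonormal_subset by blast
    moreover have "z \<in> complex_vector.span F"
      using F F0(3) complex_vector.span_mono by blast
    ultimately have "norm (x - fin_proj F x) < \<delta>"
      using fin_proj_nearest[of F z x] F z(2) by auto
    have "dist (\<Sum>e\<in>F. cinner x e * cinner e y) (cinner x y) = cmod (cinner (x - fin_proj F x) y)"
      by (simp add: dist_norm cinner_fin_proj_left[symmetric] cinner_diff_left norm_minus_commute)
    also have "\<dots> \<le> norm (x - fin_proj F x) * norm y"
      by (rule Cauchy_Schwarz_cinner)
    also have "\<dots> \<le> \<delta> * norm y"
      using \<open>norm (x - fin_proj F x) < \<delta>\<close> by (intro mult_right_mono) auto
    also have "\<dots> < \<delta> * (norm y + 1)"
      using \<open>\<delta> > 0\<close> by simp
    also have "\<dots> = r"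
      by (simp add: \<delta>_def add_nonneg_eq_0_iff)
    finally show "dist (\<Sum>e\<in>F. cinner x e * cinner e y) (cinner x y) < r" .
  qed (use F0 in auto)
qed

section \<open>Traces of finite rank operators\<close>

lemma has_sum_finite_sum:
  fixes f :: "'i \<Rightarrow> 'a \<Rightarrow> 'b::topological_comm_monoid_add"
  assumes "\<And>i. i \<in> I \<Longrightarrow> (f i has_sum c i) A"
  shows "((\<lambda>x. \<Sum>i\<in>I. f i x) has_sum (\<Sum>i\<in>I. c i)) A"
  using assms by (induction I rule: infinite_finite_induct) (auto intro: has_sum_add)

text \<open>Parseval evaluates each term to \<open>cinner (a i) (b i)\<close>, and the finite sum
  over \<open>I\<close> commutes with the sum over \<open>E\<close>. The families are arbitrary
  because products such as \<open>Y (B - A)\<close> are presented with vectors that are not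
  orthogonal.\<close>

lemma finite_rank_has_sum:
  fixes T :: "'h::complex_hilbert_space \<Rightarrow>\<^sub>L 'h"
  assumes "\<And>y. T y = (\<Sum>i\<in>I. cinner y (b i) *\<^sub>C a i)" and "orthonormal_basis E UNIV"
  shows "((\<lambda>e. cinner (T e) e) has_sum (\<Sum>i\<in>I. cinner (a i) (b i))) E"
proof -
  have "((\<lambda>e. \<Sum>i\<in>I. cinner (a i) e * cinner e (b i)) has_sum (\<Sum>i\<in>I. cinner (a i) (b i))) E"
    by (intro has_sum_finite_sum parseval_has_sum assms(2))
  then show ?thesis
    by (simp add: assms(1) cinner_sum_left cinner_scaleC_left mult.commute)
qed

lemma op_trace_finite_rank:
  fixes T :: "'h::complex_hilbert_space \<Rightarrow>\<^sub>L 'h"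
  assumes "separable_space (euclidean :: 'h topology)"
    and "\<And>y. T y = (\<Sum>i\<in>I. cinner y (b i) *\<^sub>C a i)"
  shows "op_trace T = (\<Sum>i\<in>I. cinner (a i) (b i))"
proof -
  have "orthonormal_basis (SOME E :: 'h set. orthonormal_basis E UNIV) UNIV"
    using orthonormal_basis_exists[OF assms(1)] by (rule someI_ex)
  then show ?thesis
    unfolding op_trace_def by (intro infsumI finite_rank_has_sum assms(2))
qed

text \<open>A positive operator is its own absolute value, so \<open>T\<close> serves as both
  \<open>S\<close> and \<open>P\<close> in \<open>trace_class_def\<close>.\<close>

lemma trace_class_positive_finite_rank:
  fixes T :: "'h::complex_hilbert_space \<Rightarrow>\<^sub>L 'h"
  assumes "complex_linear T" and "positive_op T" and "\<And>y. T y = (\<Sum>i\<in>I. cinner y (b i) *\<^sub>C a i)"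
  shows "T \<in> trace_class_sa"
proof -
  have "self_adjoint T"
    using assms(2) by (simp add: positive_op_def)
  moreover have "(\<lambda>e. Re (cinner (T e) e)) summable_on E" if "orthonormal_basis E UNIV" for E
    using has_sum_Re[OF finite_rank_has_sum[OF assms(3) that]] by (auto simp: summable_on_def)
  ultimately show ?thesis
    using assms(1,2) unfolding trace_class_sa_def trace_class_def self_adjoint_def by blast
qed

section \<open>Density operators on a finite-dimensional subspace\<close>

lemma cinner_ext:
  fixes u v :: "'h::complex_hilbert_space"
  assumes "\<And>x. cinner u x = cinner v x"
  shows "u = v"
proof -
  have "cinner (u - v) (u - v) = 0"
    by (simp only: cinner_diff_left assms) simp
  then show ?thesis
    by (simp add: cinner_self)
qed

lemma Re_rank_one: "Re (cinner (rank_one v x) x) = (cmod (cinner x v))\<^sup>2"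
proof -
  have "cinner (rank_one v x) x = cinner x v * cnj (cinner x v)"
    by (simp add: cinner_scaleC_left cinner_commute[of v x])
  then show ?thesis
    by (simp add: complex_norm_square[symmetric])
qed

lemma positive_op_rank_one: "positive_op (rank_one v)"
  unfolding positive_op_def Re_rank_one by (simp add: self_adjoint_rank_one)

lemma positive_op_add: "positive_op S \<Longrightarrow> positive_op T \<Longrightarrow> positive_op (S + T)"
  by (simp add: positive_op_def self_adjoint_add blinfun.add_left cinner_add_left)

lemma positive_op_scaleR: "0 \<le> r \<Longrightarrow> positive_op T \<Longrightarrow> positive_op (r *\<^sub>R T)"
  by (simp add: positive_op_def self_adjoint_scaleR blinfun.scaleR_left cinner_scaleR_left)

lemma rank_one_scaleR: "rank_one (r *\<^sub>R v) = r\<^sup>2 *\<^sub>R rank_one v"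
  by (rule blinfun_eqI)
    (simp add: cinner_scaleC_right blinfun.scaleR_left scaleR_scaleC scaleC_scaleC power2_eq_square
      mult_ac)

text \<open>This is completing the square: the form of \<open>Y - rank_one w\<close> at
  \<open>y\<close> equals the form of \<open>Y\<close> at \<open>y - k *\<^sub>C p\<close> with
  \<open>k = cinner (Y y) p / cinner (Y p) p\<close>, hence is nonnegative.\<close>

lemma positive_op_deflate:
  assumes lin: "complex_linear Y" and pos: "positive_op Y" and a: "Re (cinner (Y p) p) > 0"
  defines "w \<equiv> (1 / sqrt (Re (cinner (Y p) p))) *\<^sub>R Y p"
  shows "positive_op (Y - rank_one w)" and "Y p = rank_one w p"
proof -
  let ?a = "Re (cinner (Y p) p)"
  have sa: "self_adjoint Y"
    using pos by (simp add: positive_op_def)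
  have w: "rank_one w y = (cinner (Y y) p / of_real ?a) *\<^sub>C Y p" for y
  proof -
    have "rank_one w = (1 / ?a) *\<^sub>R rank_one (Y p)"
      using a by (simp add: w_def rank_one_scaleR power_divide del: scaleR_scaleC)
    then show ?thesis
      by (simp add: blinfun.scaleR_left scaleR_scaleC scaleC_scaleC self_adjointD[OF sa])
  qed
  have "cinner (Y p) p / of_real ?a = 1"
    using self_adjoint_Re[OF sa, of p] a by (metis divide_self less_irrefl of_real_eq_0_iff)
  then show "Y p = rank_one w p"
    unfolding w by (simp only: scaleC_one)
  have "self_adjoint (Y - rank_one w)"
    using self_adjoint_add[OF sa self_adjoint_scaleR[OF self_adjoint_rank_one, of "-1" w]] by simp
  moreover have "0 \<le> Re (cinner ((Y - rank_one w) y) y)" for y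
  proof -
    define k where "k = cinner (Y y) p / of_real ?a"
    have ka: "k * of_real ?a = cinner (Y y) p" and ka': "cnj k * of_real ?a = cinner (Y p) y"
      using a by (auto simp: k_def self_adjointD[OF sa, of p y] cinner_commute[of p "Y y"])
    have "cinner (Y (y - k *\<^sub>C p)) (y - k *\<^sub>C p) =
        cinner (Y y) y - cnj k * cinner (Y y) p - k * cinner (Y p) y + k * cnj k * cinner (Y p) p"
      by (simp add: blinfun.diff_right complex_linearD[OF lin] cinner_simps algebra_simps)
    also have "\<dots> = cinner (Y y) y - cnj k * (k * of_real ?a) - k * (cnj k * of_real ?a) +
        k * cnj k * of_real ?a"
      by (simp only: ka[symmetric] ka'[symmetric] self_adjoint_Re[OF sa])
    also have "\<dots> = cinner (Y y) y - k * (cnj k * of_real ?a)"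
      by (simp add: algebra_simps)
    also have "\<dots> = cinner ((Y - rank_one w) y) y"
      by (simp only: blinfun.diff_left w ka' cinner_diff_left cinner_scaleC_left k_def[symmetric])
    finally show ?thesis
      using pos unfolding positive_op_def by metis
  qed
  ultimately show "positive_op (Y - rank_one w)"
    by (simp add: positive_op_def)
qed

text \<open>Only invariance under the projection on the right is recorded, since
  \<open>self_adjoint_fin_proj_left\<close> recovers the left one, and the trace is a finite sum
  over \<open>Q\<close>. This keeps \<open>trace_class\<close> and \<open>op_trace\<close> out of
  the convexity arguments.\<close>

definition density_ops :: "'h::complex_hilbert_space set \<Rightarrow> ('h \<Rightarrow>\<^sub>L 'h) set" where
  "density_ops Q = {Y. complex_linear Y \<and> positive_op Y \<and> Y o\<^sub>L fin_proj Q = Y \<and>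
    (\<Sum>q\<in>Q. cinner (Y q) q) = 1}"

lemma fin_proj_expansion:
  assumes "complex_linear Y" and "Y o\<^sub>L fin_proj Q = Y"
  shows "Y y = (\<Sum>q\<in>Q. cinner y q *\<^sub>C Y q)"
proof -
  have "Y y = Y (fin_proj Q y)"
    using assms(2) by (metis blinfun_apply_blinfun_compose)
  then show ?thesis
    by (simp add: fin_proj_apply blinfun.sum_right complex_linearD[OF assms(1)])
qed

lemma self_adjoint_fin_proj_left:
  assumes "self_adjoint Y" and "Y o\<^sub>L fin_proj Q = Y"
  shows "fin_proj Q o\<^sub>L Y = Y"
proof (rule blinfun_eqI, rule cinner_ext)
  fix x y
  have "cinner (fin_proj Q (Y y)) x = cinner y (Y (fin_proj Q x))"
    by (simp add: self_adjointD[OF fin_proj_self_adjoint] self_adjointD[OF assms(1)])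
  also have "\<dots> = cinner (Y y) x"
    using assms(2) by (metis blinfun_apply_blinfun_compose self_adjointD[OF assms(1)])
  finally show "cinner ((fin_proj Q o\<^sub>L Y) y) x = cinner (Y y) x"
    by simp
qed

context
  fixes Q :: "'h::complex_hilbert_space set"
  assumes fin: "finite Q" and on: "orthonormal Q"
begin

text \<open>Two candidates for the projection differ by a vector of the span that is orthogonal to
  the span, hence to itself. This settles the \<open>THE\<close> in
  \<open>orth_proj_def\<close>.\<close>

lemma orth_proj_span: "orth_proj (complex_vector.span Q) = fin_proj Q"
  unfolding orth_proj_def
proof (rule the_equality)
  show "\<forall>x. fin_proj Q x \<in> complex_vector.span Q \<and>
      (\<forall>v\<in>complex_vector.span Q. cinner (x - fin_proj Q x) v = 0)"
    using fin_proj_in_span fin_proj_residual_orthogonal[OF fin on] by blast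
  fix P :: "'h \<Rightarrow>\<^sub>L 'h"
  assume P: "\<forall>x. P x \<in> complex_vector.span Q \<and>
      (\<forall>v\<in>complex_vector.span Q. cinner (x - P x) v = 0)"
  show "P = fin_proj Q"
  proof (rule blinfun_eqI)
    fix x
    let ?d = "P x - fin_proj Q x"
    have "?d \<in> complex_vector.span Q"
      using P fin_proj_in_span by (intro complex_vector.span_diff) auto
    then have "cinner (x - fin_proj Q x) ?d = 0" "cinner (x - P x) ?d = 0"
      using P fin_proj_residual_orthogonal[OF fin on] by auto
    then have "cinner ?d ?d = 0"
      by (simp add: cinner_diff_left)
    then show "P x = fin_proj Q x"
      by (simp add: cinner_self)
  qed
qed

lemma rank_one_fin_proj:
  assumes "v \<in> complex_vector.span Q"
  shows "rank_one v o\<^sub>L fin_proj Q = rank_one v"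
proof (rule blinfun_eqI)
  fix x
  have "cinner (fin_proj Q x) v = cinner x v"
    using assms self_adjointD[OF fin_proj_self_adjoint, of Q x v] fin_proj_span_iff[OF fin on]
    by metis
  then show "(rank_one v o\<^sub>L fin_proj Q) x = rank_one v x"
    by simp
qed

lemma trace_rank_one:
  assumes "v \<in> complex_vector.span Q"
  shows "(\<Sum>q\<in>Q. cinner (rank_one v q) q) = of_real ((norm v)\<^sup>2)"
proof -
  have "(\<Sum>q\<in>Q. cinner (rank_one v q) q) = cinner (fin_proj Q v) v"
    by (simp add: cinner_fin_proj_left cinner_scaleC_left mult.commute)
  then show ?thesis
    using assms fin_proj_span_iff[OF fin on] by (metis cinner_self)
qed

lemma rank_one_density_ops:
  "v \<in> complex_vector.span Q \<Longrightarrow> norm v = 1 \<Longrightarrow> rank_one v \<in> density_ops Q"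
  by (simp add: density_ops_def complex_linear_rank_one positive_op_rank_one rank_one_fin_proj
      trace_rank_one del: rank_one_apply)

lemma convex_density_ops: "convex (density_ops Q)"
proof (rule convexI)
  fix Y Z and u v :: real
  assume Y: "Y \<in> density_ops Q" and Z: "Z \<in> density_ops Q" and uv: "0 \<le> u" "0 \<le> v" "u + v = 1"
  have "(\<Sum>q\<in>Q. cinner ((u *\<^sub>R Y + v *\<^sub>R Z) q) q) =
      of_real u * (\<Sum>q\<in>Q. cinner (Y q) q) + of_real v * (\<Sum>q\<in>Q. cinner (Z q) q)"
    by (simp add: blinfun.add_left blinfun.scaleR_left cinner_simps sum.distrib sum_distrib_left)
  also have "\<dots> = 1"
    using Y Z uv by (simp add: density_ops_def flip: of_real_add)
  finally have tr: "(\<Sum>q\<in>Q. cinner ((u *\<^sub>R Y + v *\<^sub>R Z) q) q) = 1" .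
  have "(u *\<^sub>R Y + v *\<^sub>R Z) o\<^sub>L fin_proj Q = u *\<^sub>R (Y o\<^sub>L fin_proj Q) + v *\<^sub>R (Z o\<^sub>L fin_proj Q)"
    by (rule blinfun_eqI) (simp add: blinfun.add_left blinfun.scaleR_left)
  then show "u *\<^sub>R Y + v *\<^sub>R Z \<in> density_ops Q"
    using Y Z uv tr unfolding density_ops_def
    by (simp add: complex_linear_add complex_linear_scaleR positive_op_add positive_op_scaleR)
qed

text \<open>Diagonal Cholesky factorisation: \<open>Y p (Y p)\<^sup>* / \<langle>Y p, p\<rangle>\<close> is split off for one basis vector \<open>p\<close>
  at a time; the remainder stays positive and vanishes at \<open>p\<close>.\<close>

lemma positive_op_sum_rank_one:
  assumes "complex_linear Y" and "positive_op Y" and "Y o\<^sub>L fin_proj Q = Y"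
  shows "\<exists>w. (\<forall>q\<in>Q. w q \<in> complex_vector.span Q) \<and> Y = (\<Sum>q\<in>Q. rank_one (w q))"
proof -
  \<comment> \<open>The induction runs over the set \<open>R\<close> of basis vectors that
    \<open>Y\<close> need not annihilate yet. \<open>Q\<close> stays fixed, while \<open>Y\<close>
    changes from step to step.\<close>
  have "\<exists>w. (\<forall>q\<in>R. w q \<in> complex_vector.span Q) \<and> Y = (\<Sum>q\<in>R. rank_one (w q))"
    if "finite R" "\<forall>q\<in>Q - R. Y q = 0" "complex_linear Y" "positive_op Y" "Y o\<^sub>L fin_proj Q = Y"
    for R :: "'h set" and Y :: "'h \<Rightarrow>\<^sub>L 'h"
    using that
  proof (induction R arbitrary: Y)
    case empty
    have "Y y = 0" for y
    proof -
      have "Y y = (\<Sum>q\<in>Q. cinner y q *\<^sub>C Y q)"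
        using empty.prems by (intro fin_proj_expansion) auto
      also have "\<dots> = 0"
        using empty.prems(1) by (intro sum.neutral) simp
      finally show ?thesis .
    qed
    then have "Y = 0"
      by (intro blinfun_eqI) simp
    then show ?case
      by simp
  next
    case (insert p R)
    have sa: "self_adjoint Y"
      using insert.prems(3) by (simp add: positive_op_def)
    show ?case
    proof (cases "Re (cinner (Y p) p) > 0")
      case False
      \<comment> \<open>A diagonal entry that is not positive already forces \<open>Y p = 0\<close>,
        so \<open>p\<close> contributes the factor 0.\<close>
      then have "Y p = 0"
        using insert.prems(3) by (intro positive_op_eq_0) auto
      then obtain w where w: "\<forall>q\<in>R. w q \<in> complex_vector.span Q" "Y = (\<Sum>q\<in>R. rank_one (w q))"
        using insert.IH[of Y] insert.prems by fastforce
      have "rank_one (0 :: 'h) = 0"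
        by (rule blinfun_eqI) simp
      then have "Y = (\<Sum>q\<in>insert p R. rank_one ((w(p := 0)) q))"
        using w(2) insert.hyps by (simp cong: sum.cong)
          (intro sum.cong, auto)
      moreover have "\<forall>q\<in>insert p R. (w(p := 0)) q \<in> complex_vector.span Q"
        using w(1) by (auto intro: complex_vector.span_zero)
      ultimately show ?thesis
        by blast
    next
      case True
      define w0 where "w0 = (1 / sqrt (Re (cinner (Y p) p))) *\<^sub>R Y p"
      define Z where "Z = Y - rank_one w0"
      have pos: "positive_op Z" and Yp: "Y p = rank_one w0 p"
        using positive_op_deflate[OF insert.prems(2,3) True] by (auto simp: Z_def w0_def)
      have "fin_proj Q (Y p) = Y p"
        using self_adjoint_fin_proj_left[OF sa insert.prems(4)] by (metis blinfun_apply_blinfun_compose)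
      then have w0: "w0 \<in> complex_vector.span Q"
        using fin_proj_span_iff[OF fin on] unfolding w0_def scaleR_scaleC
        by (intro complex_vector.span_scale) auto
      \<comment> \<open>Where \<open>Y\<close> vanishes the form of \<open>Z\<close> is at most 0,
        being minus that of \<open>rank_one w0\<close>; so positivity of \<open>Z\<close> preserves
        the zeros already obtained.\<close>
      have Zq: "Z q = 0" if "Y q = 0" for q
      proof (rule positive_op_eq_0[OF pos])
        show "Re (cinner (Z q) q) \<le> 0"
          using that Re_rank_one[of w0 q] by (simp add: Z_def blinfun.diff_left cinner_diff_left cinner_minus_left)
      qed
      have "Z p = 0"
        using Yp by (simp add: Z_def blinfun.diff_left)
      then have "\<forall>q\<in>Q - R. Z q = 0"
        using insert.prems(1) Zq by blast
      moreover have "complex_linear Z"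
        unfolding Z_def using complex_linear_add[OF insert.prems(2)
            complex_linear_scaleR[OF complex_linear_rank_one, of "-1" w0]] by simp
      moreover have "Z o\<^sub>L fin_proj Q = Z"
      proof -
        have "Z o\<^sub>L fin_proj Q = (Y o\<^sub>L fin_proj Q) - (rank_one w0 o\<^sub>L fin_proj Q)"
          by (rule blinfun_eqI) (simp add: Z_def blinfun.diff_left)
        then show ?thesis
          using insert.prems(4) rank_one_fin_proj[OF w0] by (simp add: Z_def)
      qed
      ultimately obtain w where w: "\<forall>q\<in>R. w q \<in> complex_vector.span Q" "Z = (\<Sum>q\<in>R. rank_one (w q))"
        using insert.IH[of Z] pos by blast
      have "(\<Sum>q\<in>R. rank_one ((w(p := w0)) q)) = (\<Sum>q\<in>R. rank_one (w q))"
        using insert.hyps by (intro sum.cong) auto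
      then have "Y = (\<Sum>q\<in>insert p R. rank_one ((w(p := w0)) q))"
        using w(2) insert.hyps by (simp add: Z_def algebra_simps)
      moreover have "\<forall>q\<in>insert p R. (w(p := w0)) q \<in> complex_vector.span Q"
        using w(1) w0 by auto
      ultimately show ?thesis
        by blast
    qed
  qed
  from this[OF fin _ assms] show ?thesis
    by simp
qed

text \<open>The factors \<open>w q\<close> are normalised and weighted by
  \<open>(norm (w q))^2\<close>; the trace condition says that these weights add up to 1.\<close>

lemma density_ops_eq_hull:
  "density_ops Q = convex hull {rank_one v |v. v \<in> complex_vector.span Q \<and> norm v = 1}"
    (is "_ = convex hull ?S")
proof
  show "convex hull ?S \<subseteq> density_ops Q"
    by (rule hull_minimal) (auto simp: convex_density_ops rank_one_density_ops)
  show "density_ops Q \<subseteq> convex hull ?S"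
  proof
    fix Y
    assume Y: "Y \<in> density_ops Q"
    then obtain w where w: "\<forall>q\<in>Q. w q \<in> complex_vector.span Q" "Y = (\<Sum>q\<in>Q. rank_one (w q))"
      using positive_op_sum_rank_one unfolding density_ops_def by blast
    have "1 = (\<Sum>q\<in>Q. cinner (Y q) q)"
      using Y by (simp add: density_ops_def)
    also have "\<dots> = (\<Sum>q\<in>Q. \<Sum>r\<in>Q. cinner (rank_one (w r) q) q)"
      by (simp add: w(2) blinfun.sum_left cinner_sum_left)
    also have "\<dots> = (\<Sum>r\<in>Q. \<Sum>q\<in>Q. cinner (rank_one (w r) q) q)"
      by (rule sum.swap)
    also have "\<dots> = (\<Sum>r\<in>Q. of_real ((norm (w r))\<^sup>2))"
      using w(1) by (intro sum.cong refl trace_rank_one) auto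
    finally have one: "(\<Sum>r\<in>Q. (norm (w r))\<^sup>2) = 1"
      by (metis of_real_eq_1_iff of_real_sum)
    \<comment> \<open>Zero factors are dropped because \<open>sgn 0 = 0\<close> is not a unit
      vector.\<close>
    define R where "R = {q\<in>Q. w q \<noteq> 0}"
    have "(\<Sum>r\<in>R. (norm (w r))\<^sup>2 *\<^sub>R rank_one (sgn (w r))) \<in> convex hull ?S"
    proof (rule convex_sum)
      have "(\<Sum>r\<in>R. (norm (w r))\<^sup>2) = (\<Sum>r\<in>Q. (norm (w r))\<^sup>2)"
        by (rule sum.mono_neutral_left) (auto simp: R_def fin)
      then show "(\<Sum>r\<in>R. (norm (w r))\<^sup>2) = 1"
        using one by simp
      show "rank_one (sgn (w r)) \<in> convex hull ?S" if "r \<in> R" for r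
      proof (rule hull_inc, rule CollectI, intro exI[of _ "sgn (w r)"] conjI refl)
        show "sgn (w r) \<in> complex_vector.span Q"
          using that w(1) unfolding sgn_div_norm scaleR_scaleC
          by (intro complex_vector.span_scale) (auto simp: R_def)
        show "norm (sgn (w r)) = 1"
          using that by (simp add: R_def norm_sgn)
      qed
    qed (auto simp: R_def fin convex_convex_hull)
    also have "(\<Sum>r\<in>R. (norm (w r))\<^sup>2 *\<^sub>R rank_one (sgn (w r))) = (\<Sum>r\<in>R. rank_one (w r))"
    proof (rule sum.cong[OF refl])
      fix r
      have "w r = norm (w r) *\<^sub>R sgn (w r)"
        by (cases "w r = 0") (simp_all add: sgn_div_norm)
      then show "(norm (w r))\<^sup>2 *\<^sub>R rank_one (sgn (w r)) = rank_one (w r)"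
        by (metis rank_one_scaleR)
    qed
    also have "\<dots> = Y"
      unfolding w(2)
      by (rule sum.mono_neutral_left) (auto simp: R_def fin intro!: blinfun_eqI)
    finally show "Y \<in> convex hull ?S" .
  qed
qed

text \<open>By \<open>fin_proj_expansion\<close> these operators have finite rank, which yields
  membership in the trace class and evaluates \<open>op_trace\<close> as the sum over
  \<open>Q\<close>.\<close>

lemma density_ops_eq_trace_class:
  assumes sep: "separable_space (euclidean :: 'h topology)"
  shows "density_ops Q = {Y \<in> trace_class_sa. positive_op Y \<and>
    fin_proj Q o\<^sub>L Y = Y \<and> Y o\<^sub>L fin_proj Q = Y \<and> op_trace Y = 1}"
proof -
  have tr: "op_trace Y = (\<Sum>q\<in>Q. cinner (Y q) q)"
    if "complex_linear Y" "Y o\<^sub>L fin_proj Q = Y" for Y :: "'h \<Rightarrow>\<^sub>L 'h"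
    by (rule op_trace_finite_rank[OF sep fin_proj_expansion[OF that]])
  have tc: "Y \<in> trace_class_sa"
    if "complex_linear Y" "positive_op Y" "Y o\<^sub>L fin_proj Q = Y" for Y :: "'h \<Rightarrow>\<^sub>L 'h"
    by (rule trace_class_positive_finite_rank[OF that(1,2) fin_proj_expansion[OF that(1,3)]])
  have left: "fin_proj Q o\<^sub>L Y = Y"
    if "positive_op Y" "Y o\<^sub>L fin_proj Q = Y" for Y :: "'h \<Rightarrow>\<^sub>L 'h"
    using self_adjoint_fin_proj_left that by (auto simp: positive_op_def)
  have lin: "complex_linear Y" if "Y \<in> trace_class_sa" for Y :: "'h \<Rightarrow>\<^sub>L 'h"
    using that by (simp add: trace_class_sa_def trace_class_def)
  show ?thesis
    unfolding density_ops_def using tr tc left lin by (intro Collect_cong) metis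
qed

end

section \<open>Density matrices\<close>

lemma mat_adjoint_index:
  "R \<in> carrier_mat m n \<Longrightarrow> i < n \<Longrightarrow> j < m \<Longrightarrow> mat_adjoint R $$ (i, j) = conjugate (R $$ (j, i))"
  by (auto simp: mat_adjoint_def mat_of_rows_def)

lemma density_matrices_cnj:
  "R \<in> density_matrices s \<Longrightarrow> i < s \<Longrightarrow> j < s \<Longrightarrow> cnj (R $$ (i, j)) = R $$ (j, i)"
  using mat_adjoint_index[of R s s j i] by (auto simp: density_matrices_def)

lemma sandwich_expand:
  assumes "R \<in> carrier_mat s s"
  shows "sandwich s q R y = (\<Sum>i<s. \<Sum>j<s. (R $$ (i, j) * cinner y (q j)) *\<^sub>C q i)"
  using assms
  by (auto simp: sandwich_apply columns_op_def columns_op_adj_def scalar_prod_def lessThan_atLeast0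
      complex_vector.scale_sum_left intro!: sum.cong)

context
  fixes q :: "nat \<Rightarrow> 'h::complex_hilbert_space" and s :: nat
  assumes inj: "inj_on q {..<s}" and on: "orthonormal (q ` {..<s})"
begin

lemma orthonormal_family: "i < s \<Longrightarrow> j < s \<Longrightarrow> cinner (q i) (q j) = (if i = j then 1 else 0)"
  using orthonormal_cinner[OF on, of "q i" "q j"] inj by (auto simp: inj_on_eq_iff)

lemma columns_op_adj_fin_proj: "columns_op_adj s q (fin_proj (q ` {..<s}) y) = columns_op_adj s q y"
proof -
  have "cinner (fin_proj (q ` {..<s}) y) (q i) = cinner y (q i)" if "i < s" for i
    using that self_adjointD[OF fin_proj_self_adjoint, of "q ` {..<s}" y "q i"]
    by (simp add: fin_proj_basis[OF _ on])
  then show ?thesis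
    by (auto simp: columns_op_adj_def)
qed

text \<open>Let \<open>Q\<close> be the operator with columns \<open>q i\<close>. The form of
  \<open>Q R Q^*\<close> at \<open>x\<close> is the form of \<open>R\<close> at
  \<open>Q^* x\<close>, and the diagonal entries survive because the columns are
  orthonormal.\<close>

lemma sandwich_density_ops:
  assumes R: "R \<in> density_matrices s"
  shows "sandwich s q R \<in> density_ops (q ` {..<s})"
proof -
  let ?Y = "sandwich s q R"
  have carrier: "R \<in> carrier_mat s s" and trR: "(\<Sum>i<s. R $$ (i, i)) = 1"
    and posR: "\<And>v. v \<in> carrier_vec s \<Longrightarrow> 0 \<le> Re ((R *\<^sub>v v) \<bullet>c v)"
    using R by (auto simp: density_matrices_def)
  note Y = sandwich_expand[OF carrier]
  have "complex_linear ?Y"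
    by (simp add: complex_linear_def Y cinner_scaleC_left complex_vector.scale_sum_right
        scaleC_scaleC mult_ac)
  moreover have "positive_op ?Y"
    unfolding positive_op_def self_adjoint_def is_adjoint_def
  proof (intro conjI allI)
    fix x y
    have "cinner x (?Y y) = (\<Sum>i<s. \<Sum>j<s. cnj (R $$ (i, j)) * cinner (q j) y * cinner x (q i))"
      by (simp add: Y cinner_sum_right cinner_scaleC_right cinner_commute[symmetric])
    also have "\<dots> = (\<Sum>i<s. \<Sum>j<s. R $$ (j, i) * cinner (q j) y * cinner x (q i))"
      by (intro sum.cong refl) (simp add: density_matrices_cnj[OF R])
    also have "\<dots> = (\<Sum>j<s. \<Sum>i<s. R $$ (j, i) * cinner (q j) y * cinner x (q i))"
      by (rule sum.swap)
    also have "\<dots> = cinner (?Y x) y"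
      by (simp add: Y cinner_sum_left cinner_scaleC_left mult_ac)
    finally show "cinner (?Y x) y = cinner x (?Y y)"
      by simp
    let ?v = "columns_op_adj s q x"
    have "?v \<in> carrier_vec s"
      by (simp add: columns_op_adj_def)
    moreover have "R *\<^sub>v ?v \<in> carrier_vec s"
      using carrier calculation by simp
    ultimately show "0 \<le> Re (cinner (?Y x) x)"
      using posR[of ?v] by (simp add: sandwich_apply[OF carrier] columns_op_adjoint)
  qed
  moreover have "?Y o\<^sub>L fin_proj (q ` {..<s}) = ?Y"
    by (rule blinfun_eqI) (simp add: sandwich_apply[OF carrier] columns_op_adj_fin_proj)
  moreover have "(\<Sum>p\<in>q ` {..<s}. cinner (?Y p) p) = 1"
  proof -
    have "cinner (?Y (q k)) (q k) = R $$ (k, k)" if "k < s" for k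
    proof -
      have "cinner (?Y (q k)) (q k) =
          (\<Sum>i<s. \<Sum>j<s. R $$ (i, j) * cinner (q k) (q j) * cinner (q i) (q k))"
        by (simp add: Y cinner_sum_left cinner_scaleC_left)
      also have "\<dots> = (\<Sum>i<s. \<Sum>j<s. if j = k then (if i = k then R $$ (k, k) else 0) else 0)"
        using that by (intro sum.cong refl) (auto simp: orthonormal_family)
      finally show ?thesis
        using that by simp
    qed
    then show ?thesis
      using trR by (simp add: sum.reindex[OF inj])
  qed
  ultimately show ?thesis
    by (simp add: density_ops_def)
qed

text \<open>The witness is \<open>Q^* Y Q\<close>, whose entry at \<open>(i, j)\<close> is
  \<open>cinner (Y (q j)) (q i)\<close>. It is positive because its form at \<open>v\<close> is the
  form of \<open>Y\<close> at \<open>Q v\<close>, using \<open>Q^* Q v = v\<close>.\<close>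

lemma density_ops_sandwich:
  assumes Y: "Y \<in> density_ops (q ` {..<s})"
  shows "\<exists>R\<in>density_matrices s. Y = sandwich s q R"
proof -
  let ?Q = "q ` {..<s}"
  define R where "R = Matrix.mat s s (\<lambda>(i, j). cinner (Y (q j)) (q i))"
  have R: "R $$ (i, j) = cinner (Y (q j)) (q i)" if "i < s" "j < s" for i j
    using that by (simp add: R_def)
  have carrier: "R \<in> carrier_mat s s"
    by (simp add: R_def)
  have lin: "complex_linear Y" and pos: "positive_op Y" and YF: "Y o\<^sub>L fin_proj ?Q = Y"
    and tr: "(\<Sum>p\<in>?Q. cinner (Y p) p) = 1"
    using Y by (auto simp: density_ops_def)
  have sa: "self_adjoint Y"
    using pos by (simp add: positive_op_def)
  have eq: "Y = sandwich s q R"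
  proof (rule blinfun_eqI)
    fix y
    have "fin_proj ?Q (Y y) = Y y"
      using self_adjoint_fin_proj_left[OF sa YF] by (metis blinfun_apply_blinfun_compose)
    then have "Y y = (\<Sum>i<s. cinner (Y y) (q i) *\<^sub>C q i)"
      by (simp add: fin_proj_apply sum.reindex[OF inj])
    also have "\<dots> = (\<Sum>i<s. (\<Sum>j<s. R $$ (i, j) * cinner y (q j)) *\<^sub>C q i)"
    proof (intro sum.cong refl arg_cong2[where f = "(*\<^sub>C)"])
      fix i
      assume i: "i \<in> {..<s}"
      have "cinner (Y y) (q i) = (\<Sum>j<s. cinner y (q j) * cinner (Y (q j)) (q i))"
        using arg_cong[OF fin_proj_expansion[OF lin YF, of y], of "\<lambda>v. cinner v (q i)"]
        by (simp add: cinner_sum_left cinner_scaleC_left sum.reindex[OF inj])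
      then show "cinner (Y y) (q i) = (\<Sum>j<s. R $$ (i, j) * cinner y (q j))"
        using i by (simp add: R mult.commute)
    qed
    also have "\<dots> = sandwich s q R y"
      by (simp add: sandwich_expand[OF carrier] complex_vector.scale_sum_left)
    finally show "Y y = sandwich s q R y" .
  qed
  have "mat_adjoint R = R"
  proof (rule eq_matI)
    fix i j
    assume "i < dim_row R" "j < dim_col R"
    then have ij: "i < s" "j < s"
      using carrier by auto
    have "cnj (cinner (Y (q i)) (q j)) = cinner (Y (q j)) (q i)"
      by (metis cinner_commute self_adjointD[OF sa])
    then show "mat_adjoint R $$ (i, j) = R $$ (i, j)"
      using ij by (simp add: mat_adjoint_index[OF carrier] R)
  qed (use carrier in \<open>auto simp: mat_adjoint_def\<close>)
  moreover have "(\<Sum>i<s. R $$ (i, i)) = 1"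
    using tr by (simp add: R sum.reindex[OF inj])
  moreover have "0 \<le> Re ((R *\<^sub>v v) \<bullet>c v)" if v: "v \<in> carrier_vec s" for v
  proof -
    let ?x = "columns_op s q v"
    have "cinner ?x (q i) = vec_index v i" if "i < s" for i
    proof -
      have "cinner ?x (q i) = (\<Sum>j<s. if j = i then vec_index v i else 0)"
        unfolding columns_op_def cinner_sum_left cinner_scaleC_left
        using that by (intro sum.cong refl) (auto simp: orthonormal_family)
      then show ?thesis
        using that by simp
    qed
    then have adj: "columns_op_adj s q ?x = v"
      using v by (auto simp: columns_op_adj_def)
    have "R *\<^sub>v v \<in> carrier_vec s"
      using carrier v by simp
    then have "(R *\<^sub>v v) \<bullet>c v = cinner (Y ?x) ?x"
      using columns_op_adjoint[of "R *\<^sub>v v" s q ?x]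
      by (simp add: eq sandwich_apply[OF carrier] adj)
    then show ?thesis
      using pos by (simp add: positive_op_def)
  qed
  ultimately have "R \<in> density_matrices s"
    using carrier by (simp add: density_matrices_def)
  then show ?thesis
    using eq by blast
qed

lemma density_ops_eq_sandwich:
  "density_ops (q ` {..<s}) = {sandwich s q R |R. R \<in> density_matrices s}"
  using sandwich_density_ops density_ops_sandwich by blast

end

section \<open>Subgradients of the largest spectral value\<close>

text \<open>With a convex half-space, \<open>hull_minimal\<close> reduces the subgradient inequality
  for density operators to the operators \<open>rank_one v\<close>.\<close>

lemma convex_linear_functional_le:
  fixes Q :: "'h::complex_hilbert_space set" and T :: "'h \<Rightarrow>\<^sub>L 'h"
  shows "convex {Y. Re (\<Sum>q\<in>Q. cinner (blinfun_apply Y q) (T q)) \<le> c}"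
proof (rule convexI)
  fix Y Z and u v :: real
  assume Y: "Y \<in> {Y. Re (\<Sum>q\<in>Q. cinner (blinfun_apply Y q) (T q)) \<le> c}"
    and Z: "Z \<in> {Y. Re (\<Sum>q\<in>Q. cinner (blinfun_apply Y q) (T q)) \<le> c}"
    and uv: "0 \<le> u" "0 \<le> v" "u + v = 1"
  have "(\<Sum>q\<in>Q. cinner ((u *\<^sub>R Y + v *\<^sub>R Z) q) (T q)) =
      of_real u * (\<Sum>q\<in>Q. cinner (Y q) (T q)) + of_real v * (\<Sum>q\<in>Q. cinner (Z q) (T q))"
    by (simp add: blinfun.add_left blinfun.scaleR_left cinner_simps sum.distrib sum_distrib_left)
  then have "Re (\<Sum>q\<in>Q. cinner ((u *\<^sub>R Y + v *\<^sub>R Z) q) (T q)) =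
      u * Re (\<Sum>q\<in>Q. cinner (Y q) (T q)) + v * Re (\<Sum>q\<in>Q. cinner (Z q) (T q))"
    by (simp del: Re_sum)
  also have "\<dots> \<le> c"
    using Y Z uv by (intro convex_bound_le) auto
  finally show "u *\<^sub>R Y + v *\<^sub>R Z \<in> {Y. Re (\<Sum>q\<in>Q. cinner (blinfun_apply Y q) (T q)) \<le> c}"
    by simp
qed

text \<open>In finite dimension compactness of the identity replaces the division by
  \<open>\<Lambda>\<close> in \<open>spectral_gap\<close>.\<close>

lemma compact_op_id_if_finite_span:
  fixes S :: "'h::complex_hilbert_space set"
  assumes "finite S" and "complex_vector.span S = UNIV"
  shows "compact_op (id_blinfun :: 'h \<Rightarrow>\<^sub>L 'h)"
proof -
  obtain Q :: "'h set" where Q: "finite Q" "orthonormal Q" "complex_vector.span Q = UNIV"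
    using finite_orthonormal_span[OF assms(1)] assms(2) by auto
  have "id_blinfun = fin_proj Q"
    using fin_proj_span_iff[OF Q(1,2)] Q(3) by (intro blinfun_eqI) simp
  then show ?thesis
    using fin_proj_compact_sa[of Q] by (simp add: compact_sa_def)
qed

lemma compact_op_convergent_subseq:
  assumes "compact_op T" and "\<And>n. norm (u n) \<le> 1"
  shows "\<exists>l r. strict_mono (r :: nat \<Rightarrow> nat) \<and> (\<lambda>n. T (u (r n))) \<longlonglongrightarrow> l"
proof -
  have "\<forall>n. T (u n) \<in> closure (blinfun_apply T ` cball 0 1)"
    using assms(2) closure_subset by fastforce
  then obtain l r where "strict_mono (r :: nat \<Rightarrow> nat)" "((\<lambda>n. T (u n)) \<circ> r) \<longlonglongrightarrow> l"
    using assms(1) unfolding compact_op_def compact_def by meson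
  then show ?thesis
    by (auto simp: o_def)
qed

locale top_eigenspace =
  fixes A :: "'h::complex_hilbert_space \<Rightarrow>\<^sub>L 'h" and Q :: "'h set"
  assumes A: "A \<in> compact_sa" and fin: "finite Q" and on: "orthonormal Q"
    and span: "complex_vector.span Q = eigenspace A (lambda_max A)"
    and nontriv: "\<exists>x::'h. x \<noteq> 0"
begin

abbreviation \<Lambda> :: real where "\<Lambda> \<equiv> lambda_max A"

lemma inner_le: "T \<in> compact_sa \<Longrightarrow> inner (T x) x \<le> lambda_max T * (norm x)\<^sup>2" for x :: 'h
  by (rule inner_le_lambda_max[OF _ _ nontriv]) (auto simp: compact_sa_def)

lemma le_bound:
  "T \<in> compact_sa \<Longrightarrow> (\<And>x::'h. inner (T x) x \<le> r * (norm x)\<^sup>2) \<Longrightarrow> lambda_max T \<le> r"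
  by (rule lambda_max_le[OF _ _ nontriv]) (auto simp: compact_sa_def)

lemma self_adjoint_A: "self_adjoint A"
  using A by (simp add: compact_sa_def)

lemma in_span_iff: "v \<in> complex_vector.span Q \<longleftrightarrow> A v = \<Lambda> *\<^sub>R v"
  by (simp add: span eigenspace_def scaleR_scaleC)

text \<open>Without a gap there are unit vectors \<open>u n\<close> orthogonal to the eigenspace
  whose form tends to \<open>\<Lambda>\<close>. Positivity of \<open>P = \<Lambda> - A\<close> gives
  \<open>P (u n)\<close> tending to 0, and compactness makes a subsequence of \<open>u n\<close>
  converge. The limit is a unit eigenvector orthogonal to the eigenspace, which is absurd.\<close>

lemma spectral_gap:
  assumes compact: "\<Lambda> \<noteq> 0 \<or> compact_op (id_blinfun :: 'h \<Rightarrow>\<^sub>L 'h)"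
  shows "\<exists>\<mu><\<Lambda>. \<forall>x. fin_proj Q x = 0 \<longrightarrow> inner (A x) x \<le> \<mu> * (norm x)\<^sup>2"
proof (rule ccontr)
  assume no_gap: "\<not> ?thesis"
  define P where "P = \<Lambda> *\<^sub>R id_blinfun - A"
  have P: "P x = \<Lambda> *\<^sub>R x - A x" for x
    by (simp add: P_def blinfun.diff_left blinfun.scaleR_left)
  have "self_adjoint P"
    using self_adjoint_A by (simp add: self_adjoint_def is_adjoint_def P cinner_simps)
  then have pos: "positive_op P"
    using inner_le[OF A] by (simp add: positive_op_def P inner_eq_Re_cinner[symmetric]
        inner_diff_left power2_norm_eq_inner)
  have "\<exists>u. norm u = 1 \<and> fin_proj Q u = 0 \<and> \<Lambda> - 1 / real (Suc n) < inner (A u) u" for n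
  proof -
    have "\<Lambda> - 1 / real (Suc n) < \<Lambda>"
      by simp
    then obtain x where x: "fin_proj Q x = 0" "(\<Lambda> - 1 / real (Suc n)) * (norm x)\<^sup>2 < inner (A x) x"
      using no_gap by (meson not_le)
    then have "x \<noteq> 0"
      by auto
    then have "(\<Lambda> - 1 / real (Suc n)) < inner (A (sgn x)) (sgn x)"
      using x(2) by (simp add: sgn_div_norm blinfun.scaleR_right field_simps power2_eq_square)
    moreover have "fin_proj Q (sgn x) = 0"
      using x(1) by (simp add: sgn_div_norm blinfun.scaleR_right)
    ultimately show ?thesis
      using \<open>x \<noteq> 0\<close> by (metis norm_sgn)
  qed
  then obtain u where u: "\<And>n. norm (u n) = 1" "\<And>n. fin_proj Q (u n) = 0"
      "\<And>n. \<Lambda> - 1 / real (Suc n) < inner (A (u n)) (u n)"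
    by metis
  define C where "C = norm P + 1"
  have "C > 0"
    by (simp add: C_def add_nonneg_pos)
  have "(norm (P (u n)))\<^sup>2 \<le> C * (1 / real (Suc n))" for n
  proof -
    have "(norm (P (u n)))\<^sup>2 \<le> C * inner (P (u n)) (u n)"
      unfolding C_def inner_eq_Re_cinner by (rule positive_op_norm_square_le[OF pos])
    also have "\<dots> \<le> C * (1 / real (Suc n))"
      using u(3)[of n] u(1)[of n] \<open>C > 0\<close>
      by (intro mult_left_mono) (auto simp: P inner_diff_left power2_norm_eq_inner[symmetric])
    finally show ?thesis .
  qed
  then have "\<forall>\<^sub>F n in sequentially. (norm (P (u n)))\<^sup>2 \<le> C * (1 / real (Suc n))"
    by simp
  moreover have "(\<lambda>n. C * (1 / real (Suc n))) \<longlonglongrightarrow> 0"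
    by (rule tendsto_mult_right_zero[OF LIMSEQ_Suc[OF lim_1_over_n]])
  ultimately have "(\<lambda>n. (norm (P (u n)))\<^sup>2) \<longlonglongrightarrow> 0"
    by (rule tendsto_sandwich[OF _ _ tendsto_const, rotated]) simp
  then have Pu: "(\<lambda>n. P (u n)) \<longlonglongrightarrow> 0"
    by (simp add: tendsto_norm_zero_iff)
  have "\<exists>l r. strict_mono (r :: nat \<Rightarrow> nat) \<and> (\<lambda>n. u (r n)) \<longlonglongrightarrow> l"
    using compact
  proof
    assume "\<Lambda> \<noteq> 0"
    obtain l r where r: "strict_mono (r :: nat \<Rightarrow> nat)" "(\<lambda>n. A (u (r n))) \<longlonglongrightarrow> l"
      using compact_op_convergent_subseq[of A u] A u(1) by (auto simp: compact_sa_def)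
    have "(\<lambda>n. P (u (r n))) \<longlonglongrightarrow> 0"
      using LIMSEQ_subseq_LIMSEQ[OF Pu r(1)] by (simp add: o_def)
    \<comment> \<open>Since \<open>u = (P u + A u) / \<Lambda>\<close>, convergence of
      \<open>A u\<close> along the subsequence carries over to \<open>u\<close>.\<close>
    then have "(\<lambda>n. (1 / \<Lambda>) *\<^sub>R (P (u (r n)) + A (u (r n)))) \<longlonglongrightarrow> (1 / \<Lambda>) *\<^sub>R (0 + l)"
      by (intro tendsto_intros r(2))
    then have "(\<lambda>n. u (r n)) \<longlonglongrightarrow> (1 / \<Lambda>) *\<^sub>R l"
      using \<open>\<Lambda> \<noteq> 0\<close> by (simp add: P)
    then show ?thesis
      using r(1) by blast
  next
    assume "compact_op (id_blinfun :: 'h \<Rightarrow>\<^sub>L 'h)"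
    then show ?thesis
      using compact_op_convergent_subseq[of "id_blinfun :: 'h \<Rightarrow>\<^sub>L 'h" u] u(1) by auto
  qed
  then obtain l r where r: "strict_mono (r :: nat \<Rightarrow> nat)" and l: "(\<lambda>n. u (r n)) \<longlonglongrightarrow> l"
    by blast
  have "(\<lambda>n. P (u (r n))) \<longlonglongrightarrow> P l"
    by (intro tendsto_intros l)
  moreover have "(\<lambda>n. P (u (r n))) \<longlonglongrightarrow> 0"
    using LIMSEQ_subseq_LIMSEQ[OF Pu r] by (simp add: o_def)
  ultimately have "P l = 0"
    by (rule LIMSEQ_unique)
  then have "fin_proj Q l = l"
    by (simp add: fin_proj_span_iff[OF fin on] in_span_iff P)
  moreover have "(\<lambda>n. fin_proj Q (u (r n))) \<longlonglongrightarrow> fin_proj Q l"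
    by (intro tendsto_intros l)
  then have "fin_proj Q l = 0"
    by (simp add: u(2) LIMSEQ_const_iff)
  ultimately have "l = 0"
    by simp
  moreover have "(\<lambda>n. norm (u (r n))) \<longlonglongrightarrow> norm l"
    by (intro tendsto_intros l)
  then have "norm l = 1"
    by (simp add: u(1) LIMSEQ_const_iff)
  ultimately show False
    by simp
qed

lemma density_ops_subset_subdifferential:
  assumes sep: "separable_space (euclidean :: 'h topology)"
  shows "density_ops Q \<subseteq> subdifferential lambda_max A"
proof
  fix Y
  assume Y: "Y \<in> density_ops Q"
  then have lin: "complex_linear Y" and YF: "Y o\<^sub>L fin_proj Q = Y"
    by (auto simp: density_ops_def)
  have "lambda_max B - \<Lambda> \<ge> Re (op_trace (Y o\<^sub>L (B - A)))" if B: "B \<in> compact_sa" for B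
  proof -
    let ?T = "B - A"
    have "?T \<in> compact_sa"
      using compact_sa_add[OF B compact_sa_scaleR[OF A, of "-1"]] by simp
    then have sa: "self_adjoint ?T"
      by (simp add: compact_sa_def)
    \<comment> \<open>Self-adjointness moves \<open>?T\<close> onto the basis vectors, which
      presents the product as an operator of finite rank.\<close>
    have "(Y o\<^sub>L ?T) y = (\<Sum>q\<in>Q. cinner y (?T q) *\<^sub>C Y q)" for y
      unfolding blinfun_apply_blinfun_compose self_adjointD[OF sa, symmetric]
      by (rule fin_proj_expansion[OF lin YF])
    then have "op_trace (Y o\<^sub>L ?T) = (\<Sum>q\<in>Q. cinner (Y q) (?T q))"
      by (rule op_trace_finite_rank[OF sep])
    moreover have "density_ops Q \<subseteq> {Y. Re (\<Sum>q\<in>Q. cinner (blinfun_apply Y q) (?T q)) \<le> lambda_max B - \<Lambda>}"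
      unfolding density_ops_eq_hull[OF fin on]
    proof (intro hull_minimal convex_linear_functional_le subsetI)
      fix Z :: "'h \<Rightarrow>\<^sub>L 'h"
      assume "Z \<in> {rank_one v |v. v \<in> complex_vector.span Q \<and> norm v = 1}"
      then obtain v where v: "v \<in> complex_vector.span Q" "norm v = 1" and Z: "Z = rank_one v"
        by blast
      \<comment> \<open>For \<open>rank_one v\<close> the sum collapses to
        \<open>cinner (?T v) v\<close>, because the projection fixes \<open>v\<close>. The form of
        \<open>B\<close> at \<open>v\<close> is at most \<open>lambda_max B\<close>, and that of
        \<open>A\<close> is exactly \<open>\<Lambda>\<close>.\<close>
      have "(\<Sum>q\<in>Q. cinner (Z q) (?T q)) = (\<Sum>q\<in>Q. cinner (?T v) q * cinner q v)"
        unfolding Z rank_one_apply cinner_scaleC_left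
        by (simp only: self_adjointD[OF sa, symmetric] mult.commute)
      also have "\<dots> = cinner (?T v) (fin_proj Q v)"
        by (simp add: cinner_fin_proj_left[symmetric] self_adjointD[OF fin_proj_self_adjoint])
      also have "fin_proj Q v = v"
        using v(1) by (simp add: fin_proj_span_iff[OF fin on])
      finally have "Re (\<Sum>q\<in>Q. cinner (Z q) (?T q)) = inner (B v) v - inner (A v) v"
        by (simp only: inner_eq_Re_cinner blinfun.diff_left cinner_diff_left minus_complex.sel)
      also have "\<dots> \<le> lambda_max B - \<Lambda>"
        using inner_le[OF B, of v] v by (simp add: in_span_iff power2_norm_eq_inner[symmetric])
      finally show "Z \<in> {Y. Re (\<Sum>q\<in>Q. cinner (blinfun_apply Y q) (?T q)) \<le> lambda_max B - \<Lambda>}"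
        by simp
    qed
    ultimately show ?thesis
      using Y by auto
  qed
  moreover have "Y \<in> trace_class_sa"
    using Y density_ops_eq_trace_class[OF fin on sep] by blast
  ultimately show "Y \<in> subdifferential lambda_max A"
    by (simp add: subdifferential_def)
qed

text \<open>The perturbation has finite rank, so the trace in the subgradient inequality is a finite
  sum. It is applied with \<open>c = -1\<close> and a single vector, with \<open>c = 1\<close> and
  an orthonormal set, and with a negative \<open>c\<close> and \<open>G = Q\<close>.\<close>

lemma subgradient_fin_proj:
  assumes sep: "separable_space (euclidean :: 'h topology)"
    and Y: "Y \<in> subdifferential lambda_max A"
  shows "c * (\<Sum>g\<in>G. Re (cinner (Y g) g)) \<le> lambda_max (A + c *\<^sub>R fin_proj G) - \<Lambda>"
proof -
  let ?B = "A + c *\<^sub>R fin_proj G"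
  have lin: "complex_linear Y"
    using Y by (simp add: subdifferential_def trace_class_sa_def trace_class_def)
  have "?B \<in> compact_sa"
    by (intro compact_sa_add compact_sa_scaleR A fin_proj_compact_sa)
  then have "Re (op_trace (Y o\<^sub>L (?B - A))) \<le> lambda_max ?B - \<Lambda>"
    using Y unfolding subdifferential_def by blast
  moreover have "(Y o\<^sub>L (?B - A)) y = (\<Sum>g\<in>G. cinner y g *\<^sub>C (c *\<^sub>R Y g))" for y
    by (simp add: blinfun.scaleR_left blinfun.scaleR_right blinfun.sum_right fin_proj_apply
        complex_linearD[OF lin] scaleR_scaleC scaleC_scaleC complex_vector.scale_sum_right mult_ac)
  then have "op_trace (Y o\<^sub>L (?B - A)) = (\<Sum>g\<in>G. cinner (c *\<^sub>R Y g) g)"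
    by (rule op_trace_finite_rank[OF sep])
  ultimately show ?thesis
    by (simp add: cinner_scaleR_left sum_distrib_left)
qed

lemma subdifferential_positive:
  assumes "separable_space (euclidean :: 'h topology)"
    and Y: "Y \<in> subdifferential lambda_max A"
  shows "positive_op Y"
  unfolding positive_op_def
proof (intro conjI allI)
  show "self_adjoint Y"
    using Y by (simp add: subdifferential_def trace_class_sa_def)
  fix x :: 'h
  have "lambda_max (A + (-1) *\<^sub>R fin_proj {x}) \<le> \<Lambda>"
  proof (rule le_bound)
    fix y :: 'h
    have "0 \<le> inner (fin_proj {x} y) y"
      by (simp add: fin_proj_def inner_eq_Re_cinner Re_rank_one del: rank_one_apply)
    then show "inner ((A + (-1) *\<^sub>R fin_proj {x}) y) y \<le> \<Lambda> * (norm y)\<^sup>2"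
      using inner_le[OF A, of y] by (simp add: blinfun.diff_left inner_diff_left)
  qed (intro compact_sa_add compact_sa_scaleR A fin_proj_compact_sa)
  then show "0 \<le> Re (cinner (Y x) x)"
    using subgradient_fin_proj[OF assms, of "-1" "{x}"] by simp
qed

lemma inner_fin_proj:
  fixes x :: 'h
  assumes "finite G" and "orthonormal G"
  shows "inner (fin_proj G x) x = (norm (fin_proj G x))\<^sup>2"
  using self_adjoint_inner[OF fin_proj_self_adjoint, of G "fin_proj G x" x]
  by (simp add: fin_proj_idem[OF assms] power2_norm_eq_inner)

lemma subdifferential_sum_le_1:
  assumes "separable_space (euclidean :: 'h topology)"
    and "Y \<in> subdifferential lambda_max A" and G: "finite G" "orthonormal G"
  shows "(\<Sum>g\<in>G. Re (cinner (Y g) g)) \<le> 1"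
proof -
  have "lambda_max (A + 1 *\<^sub>R fin_proj G) \<le> \<Lambda> + 1"
  proof (rule le_bound)
    fix x :: 'h
    have "inner (fin_proj G x) x \<le> (norm x)\<^sup>2"
      by (simp add: inner_fin_proj[OF G] norm_fin_proj_le[OF G] power_mono)
    then show "inner ((A + 1 *\<^sub>R fin_proj G) x) x \<le> (\<Lambda> + 1) * (norm x)\<^sup>2"
      using inner_le[OF A, of x] by (simp add: blinfun.add_left inner_add_left algebra_simps)
  qed (intro compact_sa_add compact_sa_scaleR A fin_proj_compact_sa)
  then show ?thesis
    using subgradient_fin_proj[OF assms(1,2), of 1 G] by simp
qed

lemma subdifferential_sum_ge_1:
  assumes "separable_space (euclidean :: 'h topology)"
    and "\<Lambda> \<noteq> 0 \<or> compact_op (id_blinfun :: 'h \<Rightarrow>\<^sub>L 'h)"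
    and "Y \<in> subdifferential lambda_max A"
  shows "1 \<le> (\<Sum>q\<in>Q. Re (cinner (Y q) q))"
proof -
  obtain \<mu> where \<mu>: "\<mu> < \<Lambda>" "\<And>x. fin_proj Q x = 0 \<Longrightarrow> inner (A x) x \<le> \<mu> * (norm x)\<^sup>2"
    using spectral_gap[OF assms(2)] by blast
  \<comment> \<open>This multiple lowers the value on the eigenspace exactly to
    \<open>\<mu>\<close>, the bound already valid on the complement.\<close>
  let ?c = "\<mu> - \<Lambda>"
  have "lambda_max (A + ?c *\<^sub>R fin_proj Q) \<le> \<mu>"
  proof (rule le_bound)
    fix x :: 'h
    let ?v = "fin_proj Q x" and ?w = "x - fin_proj Q x"
    have Av: "A ?v = \<Lambda> *\<^sub>R ?v"
      using fin_proj_in_span in_span_iff by blast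
    have orth: "inner ?v ?w = 0"
      using inner_fin_proj[OF fin on, of x]
      by (simp add: inner_diff_right power2_norm_eq_inner)
    \<comment> \<open>The cross terms vanish because \<open>A v\<close> is a multiple of
      \<open>v\<close> and \<open>w\<close> is orthogonal to \<open>v\<close>.\<close>
    have split: "inner (A (v + w)) (v + w) = \<Lambda> * (norm v)\<^sup>2 + inner (A w) w"
      if "A v = \<Lambda> *\<^sub>R v" "inner v w = 0" for v w
      using self_adjoint_inner[OF self_adjoint_A, of w v] that
      by (simp add: blinfun.add_right inner_add_left inner_add_right power2_norm_eq_inner
          inner_commute[of w v])
    have "inner (A x) x = \<Lambda> * (norm ?v)\<^sup>2 + inner (A ?w) ?w"
      using split[OF Av orth] by simp
    also have "inner (A ?w) ?w \<le> \<mu> * (norm ?w)\<^sup>2"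
      by (rule \<mu>(2)) (simp add: blinfun.diff_right fin_proj_idem[OF fin on])
    finally have "inner (A x) x + ?c * (norm ?v)\<^sup>2 \<le> \<mu> * ((norm ?v)\<^sup>2 + (norm ?w)\<^sup>2)"
      by (simp add: algebra_simps)
    then show "inner ((A + ?c *\<^sub>R fin_proj Q) x) x \<le> \<mu> * (norm x)\<^sup>2"
      by (simp only: pythagoras_fin_proj[OF fin on, of x, symmetric] blinfun.add_left
          blinfun.scaleR_left inner_add_left inner_scaleR_left inner_fin_proj[OF fin on])
  qed (intro compact_sa_add compact_sa_scaleR A fin_proj_compact_sa)
  \<comment> \<open>\<open>?c\<close> is negative, so cancelling it turns this into a lower bound
    for the sum.\<close>
  then have "?c * (\<Sum>q\<in>Q. Re (cinner (Y q) q)) \<le> ?c * 1"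
    using order_trans[OF subgradient_fin_proj[OF assms(1,3), of ?c Q] diff_right_mono] by simp
  then show ?thesis
    using \<mu>(1) by (simp only: mult_le_cancel_left)
qed

lemma subdifferential_subset_density_ops:
  assumes sep: "separable_space (euclidean :: 'h topology)"
    and compact: "\<Lambda> \<noteq> 0 \<or> compact_op (id_blinfun :: 'h \<Rightarrow>\<^sub>L 'h)"
  shows "subdifferential lambda_max A \<subseteq> density_ops Q"
proof
  fix Y
  assume Y: "Y \<in> subdifferential lambda_max A"
  note pos = subdifferential_positive[OF sep Y]
    and ge = subdifferential_sum_ge_1[OF sep compact Y]
    and le = subdifferential_sum_le_1[OF sep Y]
  have lin: "complex_linear Y"
    using Y by (simp add: subdifferential_def trace_class_sa_def trace_class_def)
  have "(\<Sum>q\<in>Q. cinner (Y q) q) = of_real (\<Sum>q\<in>Q. Re (cinner (Y q) q))"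
    using pos by (simp add: self_adjoint_Re positive_op_def)
  then have tr: "(\<Sum>q\<in>Q. cinner (Y q) q) = 1"
    using ge le[OF fin on] by (metis antisym of_real_1)
  \<comment> \<open>\<open>Q\<close> already exhausts the bound 1. Adding a unit vector
    \<open>?u\<close> orthogonal to \<open>Q\<close> therefore leaves
    \<open>Re (cinner (Y ?u) ?u) \<le> 0\<close>, and positivity gives
    \<open>Y ?u = 0\<close>.\<close>
  have kernel: "Y w = 0" if w: "fin_proj Q w = 0" for w
  proof (cases "w = 0")
    case False
    let ?u = "sgn w"
    have Fu: "fin_proj Q ?u = 0"
      by (simp add: sgn_div_norm blinfun.scaleR_right w)
    have "norm ?u = 1"
      using False by (simp add: norm_sgn)
    have orth: "cinner ?u q = 0" "cinner q ?u = 0" if "q \<in> Q" for q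
    proof -
      show "cinner ?u q = 0"
        using fin_proj_residual_orthogonal[OF fin on complex_vector.span_base[OF that], of ?u]
        by (simp add: Fu)
      then show "cinner q ?u = 0"
        by (metis cinner_commute complex_cnj_zero)
    qed
    then have "orthonormal (insert ?u Q)"
      using on \<open>norm ?u = 1\<close> by (auto simp: orthonormal_def)
    then have "(\<Sum>g\<in>insert ?u Q. Re (cinner (Y g) g)) \<le> 1"
      using le fin by blast
    moreover have "?u \<notin> Q"
      using fin_proj_basis[OF fin on, of ?u] Fu \<open>norm ?u = 1\<close> by auto
    ultimately have "Re (cinner (Y ?u) ?u) \<le> 0"
      using ge fin by simp
    then have "Y ?u = 0"
      by (rule positive_op_eq_0[OF pos])
    then show ?thesis
      using False by (simp add: sgn_div_norm blinfun.scaleR_right)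
  qed simp
  have "Y o\<^sub>L fin_proj Q = Y"
  proof (rule blinfun_eqI)
    fix x
    have "Y (x - fin_proj Q x) = 0"
      by (rule kernel) (simp add: blinfun.diff_right fin_proj_idem[OF fin on])
    then show "(Y o\<^sub>L fin_proj Q) x = Y x"
      by (simp add: blinfun.diff_right)
  qed
  then show "Y \<in> density_ops Q"
    using lin pos tr by (simp add: density_ops_def)
qed

lemma density_ops_eq_D_Smax: "density_ops Q = D_Smax A"
  by (simp add: density_ops_eq_hull[OF fin on] D_Smax_def span)

end

section \<open>From the multiplicity to an orthonormal eigenbasis, and the final assembly\<close>

lemma eigenspace_subspace:
  assumes "complex_linear A"
  shows "complex_vector.subspace (eigenspace A r)"
  using assms
  by (auto simp: complex_vector.subspace_def eigenspace_def blinfun.add_right scaleC_add_right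
      complex_linearD scaleC_scaleC mult.commute)

lemma finite_basis_if_dim_pos:
  fixes V :: "'h::complex_hilbert_space set"
  assumes "complex_vector.subspace V" and "complex_vector.dim V \<ge> 1"
  shows "\<exists>b. finite b \<and> complex_vector.span b = V"
proof -
  obtain b where b: "b \<subseteq> V" "complex_vector.independent b" "V \<subseteq> complex_vector.span b"
      "card b = complex_vector.dim V"
    using complex_vector.basis_exists by blast
  have "complex_vector.span b = V"
    using b(1,3) assms(1) by (intro antisym complex_vector.span_minimal)
  \<comment> \<open>\<open>card\<close> of an infinite set is 0, so a dimension of at least 1 makes
    \<open>b\<close> finite.\<close>
  then show ?thesis
    using b(4) assms(2) by (metis card.infinite not_one_le_zero)
qed

text \<open>The span is the fixed point set of a continuous map, hence closed.\<close>

lemma closure_span_finite_orthonormal: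
  fixes Q :: "'h::complex_hilbert_space set"
  assumes "finite Q" and "orthonormal Q"
  shows "closure (complex_vector.span Q) = complex_vector.span Q"
proof -
  have "complex_vector.span Q = {x. fin_proj Q x = x}"
    using fin_proj_span_iff[OF assms] by blast
  then show ?thesis
    by (simp add: closed_Collect_eq continuous_intros)
qed

text \<open>The condition on the first equality is genuine: on an infinite-dimensional space with
  \<open>lambda_max A = 0\<close> the zero operator is a subgradient, although its trace is
  0.\<close>

theorem proposition6:
  fixes A :: "'h::complex_hilbert_space \<Rightarrow>\<^sub>L 'h" and s :: nat
  assumes "separable_space (euclidean :: 'h topology)"
    and "A \<in> compact_sa"
    and "eigen_mult A (lambda_max A) = s" and "s \<ge> 1"
  shows "(lambda_max A \<noteq> 0 \<or> (\<exists>S :: 'h set. finite S \<and> complex_vector.span S = UNIV) \<longrightarrow>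
        subdifferential lambda_max A = D_Smax A)
    \<and> D_Smax A =
        {Y \<in> trace_class_sa. positive_op Y \<and>
          orth_proj (eigenspace A (lambda_max A)) o\<^sub>L Y = Y \<and>
          Y o\<^sub>L orth_proj (eigenspace A (lambda_max A)) = Y \<and> op_trace Y = 1}
    \<and> (lambda_max A \<noteq> 0 \<longrightarrow>
        (\<forall>q. inj_on q {..<s} \<and> orthonormal_basis (q ` {..<s}) (eigenspace A (lambda_max A)) \<longrightarrow>
          subdifferential lambda_max A = {sandwich s q R |R. R \<in> density_matrices s}))"
proof -
  let ?V = "eigenspace A (lambda_max A)"
  have lin: "complex_linear A"
    using assms(2) by (simp add: compact_sa_def)
  obtain b where b: "finite b" "complex_vector.span b = ?V"
    using finite_basis_if_dim_pos[OF eigenspace_subspace[OF lin]] assms(3,4)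
    unfolding eigen_mult_def by blast
  obtain Q where Q: "finite Q" "orthonormal Q" "complex_vector.span Q = ?V"
    using finite_orthonormal_span[OF b(1)] b(2) by auto
  \<comment> \<open>In the zero space every eigenspace has dimension 0, contrary to
    \<open>s \<ge> 1\<close>.\<close>
  have nontriv: "\<exists>x::'h. x \<noteq> 0"
  proof (rule ccontr)
    assume "\<not> ?thesis"
    then have "?V \<subseteq> complex_vector.span {}"
      by auto
    then have "complex_vector.dim ?V = 0"
      using complex_vector.dim_le_card[of ?V "{}"] by simp
    then show False
      using assms(3,4) by (simp add: eigen_mult_def)
  qed
  interpret top_eigenspace A Q
    by unfold_locales (use assms(2) Q nontriv in auto)
  have eq: "subdifferential lambda_max A = D_Smax A"
    if "lambda_max A \<noteq> 0 \<or> compact_op (id_blinfun :: 'h \<Rightarrow>\<^sub>L 'h)"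
    using subdifferential_subset_density_ops[OF assms(1) that]
      density_ops_subset_subdifferential[OF assms(1)] density_ops_eq_D_Smax by blast
  show ?thesis
  proof (intro conjI impI allI)
    assume "lambda_max A \<noteq> 0 \<or> (\<exists>S :: 'h set. finite S \<and> complex_vector.span S = UNIV)"
    then show "subdifferential lambda_max A = D_Smax A"
      using eq compact_op_id_if_finite_span by blast
  next
    show "D_Smax A = {Y \<in> trace_class_sa. positive_op Y \<and> orth_proj ?V o\<^sub>L Y = Y \<and>
        Y o\<^sub>L orth_proj ?V = Y \<and> op_trace Y = 1}"
      using density_ops_eq_trace_class[OF Q(1,2) assms(1)] orth_proj_span[OF Q(1,2)]
      by (simp add: Q(3) density_ops_eq_D_Smax)
  next
    fix q
    assume "lambda_max A \<noteq> 0" and q: "inj_on q {..<s} \<and> orthonormal_basis (q ` {..<s}) ?V"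
    \<comment> \<open>For a finite family the closure in \<open>orthonormal_basis\<close>
      disappears, so the given columns and \<open>Q\<close> span the same space and lead to the same
      convex hull.\<close>
    then have on': "orthonormal (q ` {..<s})" and "complex_vector.span (q ` {..<s}) = ?V"
      using closure_span_finite_orthonormal[of "q ` {..<s}"] by (auto simp: orthonormal_basis_def)
    then have "density_ops (q ` {..<s}) = D_Smax A"
      by (simp add: density_ops_eq_hull D_Smax_def)
    then show "subdifferential lambda_max A = {sandwich s q R |R. R \<in> density_matrices s}"
      using eq \<open>lambda_max A \<noteq> 0\<close> density_ops_eq_sandwich[of q s] on' q by simp
  qed
qed

end
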